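(* For $N\ge 3$ there is a quantum circuit, with a primary register of $n=\lceil\log_2N\rceil$ qubits and an ancillary register, using in total $O(N\log_2N)$ qubits and $O(N^3\log_2N)$ gates (from the gate set described in the context), that performs uniform random sampling of permutations of $N$ elements: the ancillary register is prepared, independently of the primary register, in the state $\bigotimes_{k=0}^{N-2}|\Pi_k\rangle_{k+2}$, where $|\Pi_k\rangle_{k+2}=\frac{1}{\sqrt{k+2}}\sum_{j=0}^{k+1}|j\rangle_{k+2}$; for each $k$ and each $j$ the gate $\Pi_k[j]$ is applied to the primary register controlled on the $k$-th ancillary system being in state $|j\rangle_{k+2}$; and upon measuring all ancillary systems in their computational bases, the resulting operation on the primary register is the permutation matrix of a permutation in $\mathcal{S}_N$, each of the $N!$ permutations occurring with probability $1/N!$.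
   Context: $\mathcal{S}_N$ is the group of permutations of $\{0,\ldots,N-1\}$; $s_j=(j,j+1)$ are the adjacent transpositions; for $0\le k\le N-2$, $\Pi_k$ is the ordered set $\{I, s_k, s_ks_{k-1},\ldots,s_ks_{k-1}\cdots s_0\}$ with elements $\Pi_k[0]=I$, $\Pi_k[1]=s_k$, ..., $\Pi_k[k+1]=s_ks_{k-1}\cdots s_0$. A permutation of $\{0,\ldots,N-1\}$ acts on the primary register $\mathbb{C}^{2^n}$ by its permutation matrix on the canonical basis vectors $|q\rangle$, $0\le q\le 2^n-1$, fixing the basis vectors with label $\ge N$. The $k$-th ancillary system has dimension $k+2$ and is realized in $\lceil\log_2(k+2)\rceil$ qubits, $|j\rangle_{k+2}$ ($0\le j\le k+1$) being canonical basis states. Gate set: arbitrary one-qubit gates and CNOT gates for preparing the ancillary register from $|0\cdots0\rangle$; and, on the primary register, one-qubit $X$ gates, CNOT gates and the standard $n$-qubit Toffoli gate (flipping the last qubit iff the other $n-1$ qubits are all $|1\rangle$), each possibly controlled on one ancillary system being in a specified basis state $|j\rangle_{k+2}$, each such (controlled) gate counting as one gate. *)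

theory Defs
  imports
    Complex_Main
    "HOL-Library.Landau_Symbols"
    "HOL-Combinatorics.Permutations"
    "Jordan_Normal_Form.Schur_Decomposition"
begin

section \<open>Permutations\<close>

text \<open>Products of permutations, like products of their matrices, act from right to left:
  \<open>Pi_elem k j\<close> is \<open>s\<^sub>k \<circ> s\<^sub>k\<^sub>-\<^sub>1 \<circ> \<dots> \<circ> s\<^sub>k\<^sub>-\<^sub>j\<^sub>+\<^sub>1\<close>, for \<open>j \<le> k + 1\<close>, where \<open>s\<^sub>i\<close> is \<open>adj_transp i\<close>.\<close>

definition adj_transp :: "nat \<Rightarrow> nat \<Rightarrow> nat" where
  "adj_transp i = transpose i (i + 1)"

primrec Pi_elem :: "nat \<Rightarrow> nat \<Rightarrow> nat \<Rightarrow> nat" where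
  "Pi_elem k 0 = id"
| "Pi_elem k (Suc j) = Pi_elem k j \<circ> adj_transp (k - j)"

text \<open>The matrix with \<open>|y\<rangle> \<mapsto> |f y\<rangle>\<close> on \<open>m\<close> qubits; a permutation matrix when \<open>f\<close> permutes
  the labels below \<open>2 ^ m\<close>.  A function with \<open>f permutes {..<N}\<close> fixes all labels \<open>\<ge> N\<close>.\<close>

definition basis_map_mat :: "nat \<Rightarrow> (nat \<Rightarrow> nat) \<Rightarrow> complex mat" where
  "basis_map_mat m f = mat (2 ^ m) (2 ^ m) (\<lambda>(x, y). if x = f y then 1 else 0)"


section \<open>Registers\<close>

text \<open>A basis state of \<open>m\<close> qubits is a label \<open>x < 2 ^ m\<close>; qubit \<open>i\<close> is the one of weight
  \<open>2 ^ i\<close>, so that qubit \<open>0\<close> is the last one in \<open>|x\<^sub>m\<^sub>-\<^sub>1 \<dots> x\<^sub>1 x\<^sub>0\<rangle>\<close>.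
  In the whole system the primary register occupies the low-order qubits, and the ancillary systems
  \<open>0, \<dots>, N - 2\<close> follow it in this order.\<close>

definition prim_qubits :: "nat \<Rightarrow> nat" where
  "prim_qubits N = nat \<lceil>log 2 (real N)\<rceil>"

definition sys_qubits :: "nat \<Rightarrow> nat" where
  "sys_qubits k = nat \<lceil>log 2 (real (k + 2))\<rceil>"

definition sys_offset :: "nat \<Rightarrow> nat" where
  "sys_offset k = (\<Sum>i<k. sys_qubits i)"

definition anc_qubits :: "nat \<Rightarrow> nat" where
  "anc_qubits N = (\<Sum>k<N - 1. sys_qubits k)"

definition total_qubits :: "nat \<Rightarrow> nat" where
  "total_qubits N = prim_qubits N + anc_qubits N"

definition prim_label :: "nat \<Rightarrow> nat \<Rightarrow> nat" where
  "prim_label N x = take_bit (prim_qubits N) x"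

definition anc_label :: "nat \<Rightarrow> nat \<Rightarrow> nat" where
  "anc_label N x = drop_bit (prim_qubits N) x"

definition join_label :: "nat \<Rightarrow> nat \<Rightarrow> nat \<Rightarrow> nat" where
  "join_label N q a = q + push_bit (prim_qubits N) a"

text \<open>The label of the \<open>k\<close>-th ancillary system within a label \<open>a\<close> of the ancillary register.\<close>

definition sys_label :: "nat \<Rightarrow> nat \<Rightarrow> nat" where
  "sys_label k a = take_bit (sys_qubits k) (drop_bit (sys_offset k) a)"

definition tensor_state :: "nat \<Rightarrow> complex vec \<Rightarrow> complex vec \<Rightarrow> complex vec" where
  "tensor_state N \<psi> \<phi> =
     vec (2 ^ total_qubits N) (\<lambda>x. \<psi> $ prim_label N x * \<phi> $ anc_label N x)"

definition Pi_state :: "nat \<Rightarrow> complex vec" where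
  "Pi_state k = vec (2 ^ sys_qubits k)
     (\<lambda>j. if j \<le> k + 1 then complex_of_real (1 / sqrt (real (k + 2))) else 0)"

definition anc_product_state :: "nat \<Rightarrow> complex vec" where
  "anc_product_state N = vec (2 ^ anc_qubits N) (\<lambda>a. \<Prod>k<N - 1. Pi_state k $ sys_label k a)"


section \<open>Gates and circuits\<close>

definition one_qubit_mat :: "nat \<Rightarrow> nat \<Rightarrow> complex mat \<Rightarrow> complex mat" where
  "one_qubit_mat m i U = mat (2 ^ m) (2 ^ m) (\<lambda>(x, y).
     if unset_bit i x = unset_bit i y then U $$ (of_bool (bit x i), of_bool (bit y i)) else 0)"

definition cnot_map :: "nat \<Rightarrow> nat \<Rightarrow> nat \<Rightarrow> nat" where
  "cnot_map c t x = (if bit x c then flip_bit t x else x)"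

definition toffoli_map :: "nat \<Rightarrow> nat \<Rightarrow> nat" where
  "toffoli_map n x = (if \<forall>i\<in>{1..<n}. bit x i then flip_bit 0 x else x)"

text \<open>The operator \<open>U\<close> of the primary register, acting on the whole system: always (\<open>None\<close>), or
  only if the \<open>k\<close>-th ancillary system is in basis state \<open>j\<close> (\<open>Some (k, j)\<close>).\<close>

fun control_holds :: "(nat \<times> nat) option \<Rightarrow> nat \<Rightarrow> bool" where
  "control_holds None a = True"
| "control_holds (Some (k, j)) a = (sys_label k a = j)"

definition primary_op :: "nat \<Rightarrow> (nat \<times> nat) option \<Rightarrow> complex mat \<Rightarrow> complex mat" where
  "primary_op N ctrl U = mat (2 ^ total_qubits N) (2 ^ total_qubits N) (\<lambda>(x, y).
     if anc_label N x \<noteq> anc_label N y then 0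
     else if control_holds ctrl (anc_label N y) then U $$ (prim_label N x, prim_label N y)
     else if x = y then 1 else 0)"

datatype prim_gate = PX nat | PCNOT nat nat | PToffoli

datatype gate =
    AncU nat "complex mat"
  | AncCNOT nat nat
  | Prim "(nat \<times> nat) option" prim_gate

fun prim_gate_mat :: "nat \<Rightarrow> prim_gate \<Rightarrow> complex mat" where
  "prim_gate_mat n (PX i) = basis_map_mat n (flip_bit i)"
| "prim_gate_mat n (PCNOT c t) = basis_map_mat n (cnot_map c t)"
| "prim_gate_mat n PToffoli = basis_map_mat n (toffoli_map n)"

text \<open>Qubits in \<open>AncU\<close> and \<open>AncCNOT\<close> are numbered within the ancillary register.\<close>

fun gate_mat :: "nat \<Rightarrow> gate \<Rightarrow> complex mat" where
  "gate_mat N (AncU i U) = one_qubit_mat (total_qubits N) (prim_qubits N + i) U"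
| "gate_mat N (AncCNOT c t) =
     basis_map_mat (total_qubits N) (cnot_map (prim_qubits N + c) (prim_qubits N + t))"
| "gate_mat N (Prim ctrl g) = primary_op N ctrl (prim_gate_mat (prim_qubits N) g)"

fun valid_prim_gate :: "nat \<Rightarrow> prim_gate \<Rightarrow> bool" where
  "valid_prim_gate n (PX i) = (i < n)"
| "valid_prim_gate n (PCNOT c t) = (c < n \<and> t < n \<and> c \<noteq> t)"
| "valid_prim_gate n PToffoli = True"

fun valid_control :: "nat \<Rightarrow> (nat \<times> nat) option \<Rightarrow> bool" where
  "valid_control N None = True"
| "valid_control N (Some (k, j)) = (k < N - 1 \<and> j \<le> k + 1)"

fun ancillary_gate :: "nat \<Rightarrow> gate \<Rightarrow> bool" where
  "ancillary_gate N (AncU i U) =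
     (i < anc_qubits N \<and> U \<in> carrier_mat 2 2 \<and> U * mat_adjoint U = 1\<^sub>m 2)"
| "ancillary_gate N (AncCNOT c t) = (c < anc_qubits N \<and> t < anc_qubits N \<and> c \<noteq> t)"
| "ancillary_gate N (Prim ctrl g) = False"

fun primary_gate :: "nat \<Rightarrow> gate \<Rightarrow> bool" where
  "primary_gate N (Prim ctrl g) = (valid_control N ctrl \<and> valid_prim_gate (prim_qubits N) g)"
| "primary_gate N _ = False"

text \<open>The head of the list is the gate applied first.\<close>

primrec circuit_mat :: "nat \<Rightarrow> gate list \<Rightarrow> complex mat" where
  "circuit_mat N [] = 1\<^sub>m (2 ^ total_qubits N)"
| "circuit_mat N (g # gs) = circuit_mat N gs * gate_mat N g"

text \<open>Preparation, followed by the blocks \<open>B k j\<close>, which are to implement the controlled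
  \<open>Pi_elem k j\<close>.  They come in the order \<open>k = N - 2, \<dots>, 0\<close>, so that the permutation applied is
  \<open>Pi_elem 0 j\<^sub>0 \<circ> Pi_elem 1 j\<^sub>1 \<circ> \<dots>\<close>.  With right-to-left products the order matters:
  for \<open>N = 3\<close> the opposite one gives \<open>Pi_elem 1 j\<^sub>1 \<circ> Pi_elem 0 j\<^sub>0\<close>, which misses
  some permutations.\<close>

definition sampling_circuit ::
  "nat \<Rightarrow> gate list \<Rightarrow> (nat \<Rightarrow> nat \<Rightarrow> gate list) \<Rightarrow> gate list" where
  "sampling_circuit N prep B =
     prep @ concat (map (\<lambda>k. concat (map (B k) [0..<k + 2])) (rev [0..<N - 1]))"


section \<open>Measurement of the ancillary register\<close>

definition norm_sq :: "complex vec \<Rightarrow> real" where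
  "norm_sq v = (\<Sum>i<dim_vec v. (cmod (v $ i))\<^sup>2)"

text \<open>Measuring every ancillary system in its computational basis gives a label \<open>a\<close> of the
  ancillary register, the result for the \<open>k\<close>-th system being \<open>sys_label k a\<close>.
  \<open>outcome_branch N \<Phi> a\<close> is the (unnormalised) component \<open>\<langle>a|\<Phi>\<rangle>\<close> in the primary register.\<close>

definition outcome_branch :: "nat \<Rightarrow> complex vec \<Rightarrow> nat \<Rightarrow> complex vec" where
  "outcome_branch N \<Phi> a = vec (2 ^ prim_qubits N) (\<lambda>q. \<Phi> $ join_label N q a)"

definition outcome_prob :: "nat \<Rightarrow> complex vec \<Rightarrow> nat \<Rightarrow> real" where
  "outcome_prob N \<Phi> a = norm_sq (outcome_branch N \<Phi> a)"

definition post_state :: "nat \<Rightarrow> complex vec \<Rightarrow> nat \<Rightarrow> complex vec" where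
  "post_state N \<Phi> a =
     complex_of_real (1 / sqrt (outcome_prob N \<Phi> a)) \<cdot>\<^sub>v outcome_branch N \<Phi> a"

definition output_state :: "nat \<Rightarrow> gate list \<Rightarrow> complex vec \<Rightarrow> complex vec" where
  "output_state N c \<psi> =
     circuit_mat N c *\<^sub>v tensor_state N \<psi> (unit_vec (2 ^ anc_qubits N) 0)"

text \<open>The permutation \<open>\<sigma> a\<close> applied on outcome \<open>a\<close> does not depend on the input state.\<close>

definition samples_uniformly :: "nat \<Rightarrow> gate list \<Rightarrow> bool" where
  "samples_uniformly N c \<longleftrightarrow>
     (\<exists>\<sigma> :: nat \<Rightarrow> nat \<Rightarrow> nat. \<forall>\<psi> \<in> carrier_vec (2 ^ prim_qubits N). norm_sq \<psi> = 1 \<longrightarrow>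
        (\<forall>a < 2 ^ anc_qubits N. outcome_prob N (output_state N c \<psi>) a \<noteq> 0 \<longrightarrow>
           \<sigma> a permutes {..<N} \<and>
           post_state N (output_state N c \<psi>) a = basis_map_mat (prim_qubits N) (\<sigma> a) *\<^sub>v \<psi>) \<and>
        (\<forall>\<pi>. \<pi> permutes {..<N} \<longrightarrow>
           (\<Sum>a | a < 2 ^ anc_qubits N \<and> \<sigma> a = \<pi>. outcome_prob N (output_state N c \<psi>) a)
             = 1 / fact N))"

end

theory Submission
  imports Defs
begin

text \<open>The gates after the preparation permute basis labels; together they form the basis map
  \<open>|q\<rangle>|a\<rangle> \<mapsto> |\<sigma>\<^sub>a q\<rangle>|a\<rangle>\<close> with \<open>\<sigma>\<^sub>a = Pi_elem 0 j\<^sub>0 \<circ> Pi_elem 1 j\<^sub>1 \<circ> \<dots>\<close>, where \<open>j\<^sub>k\<close> is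
  the label of the \<open>k\<close>-th system in \<open>a\<close>.  Since \<open>Pi_elem k j\<close> sends \<open>k + 1 - j\<close> to \<open>k + 1\<close>, which
  all factors with a smaller index fix, the factors can be read off from \<open>\<sigma>\<^sub>a\<close> one after the other,
  so that each permutation arises from exactly one \<open>a\<close>, of probability \<open>1 / N!\<close>.

  A uniform superposition on \<open>m\<close> qubits is prepared along the binary tree of the leading bits: the
  next qubit is rotated by an angle that depends on the preceding ones and splits the weight of
  their subtree correctly.  Such a multiplexed rotation with \<open>c\<close> controls takes \<open>O(2\<^sup>c)\<close> one-qubit and
  CNOT gates.\<close>

section \<open>Registers and basis maps\<close>

abbreviation basis_preserving :: "nat \<Rightarrow> (nat \<Rightarrow> nat) \<Rightarrow> bool" where
  "basis_preserving m f \<equiv> \<forall>x < 2 ^ m. f x < 2 ^ m"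

text \<open>Reduces bounds on labels to single bits, where the effect of setting, clearing or
  flipping a bit can be read off.\<close>

lemma less_exp_iff_no_high_bits: "(x::nat) < 2 ^ m \<longleftrightarrow> (\<forall>i\<ge>m. \<not> bit x i)"
proof -
  have "x < 2 ^ m \<longleftrightarrow> take_bit m x = x"
    by (simp only: take_bit_nat_eq_self_iff)
  also have "\<dots> \<longleftrightarrow> (\<forall>i. (i < m \<and> bit x i) = bit x i)"
    by (simp only: bit_eq_iff[of "take_bit m x"] bit_take_bit_iff possible_bit_nat simp_thms)
  also have "\<dots> \<longleftrightarrow> (\<forall>i\<ge>m. \<not> bit x i)"
    by (meson not_le)
  finally show ?thesis .
qed

lemma prim_label_less [simp]: "prim_label N x < 2 ^ prim_qubits N"
  by (simp add: prim_label_def)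

lemma anc_label_less [simp]:
  "x < 2 ^ total_qubits N \<Longrightarrow> anc_label N x < 2 ^ anc_qubits N"
  unfolding anc_label_def total_qubits_def drop_bit_eq_div power_add
  by (rule less_mult_imp_div_less) (simp only: mult.commute)

lemma join_label_less [simp]:
  assumes "q < 2 ^ prim_qubits N" "a < 2 ^ anc_qubits N"
  shows "join_label N q a < 2 ^ total_qubits N"
proof -
  have "(a + 1) * 2 ^ prim_qubits N \<le> 2 ^ anc_qubits N * (2::nat) ^ prim_qubits N"
    by (rule mult_le_mono1) (use assms in simp)
  then show ?thesis
    using assms by (simp add: join_label_def total_qubits_def push_bit_eq_mult power_add algebra_simps)
qed

lemma prim_label_join [simp]:
  "q < 2 ^ prim_qubits N \<Longrightarrow> prim_label N (join_label N q a) = q"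
  by (simp add: join_label_def prim_label_def push_bit_eq_mult take_bit_eq_mod)

lemma anc_label_join [simp]:
  "q < 2 ^ prim_qubits N \<Longrightarrow> anc_label N (join_label N q a) = a"
  by (simp add: join_label_def anc_label_def push_bit_eq_mult drop_bit_eq_div)

lemma join_label_split [simp]: "join_label N (prim_label N x) (anc_label N x) = x"
  by (simp add: join_label_def anc_label_def prim_label_def push_bit_eq_mult drop_bit_eq_div
      take_bit_eq_mod mod_div_mult_eq)

lemma label_eqI:
  "prim_label N x = prim_label N y \<Longrightarrow> anc_label N x = anc_label N y \<Longrightarrow> x = y"
  by (metis join_label_split)

lemma tensor_state_carrier [simp]: "tensor_state N \<psi> \<phi> \<in> carrier_vec (2 ^ total_qubits N)"
  by (simp add: tensor_state_def)

lemma join_label_eq_iff: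
  "q < 2 ^ prim_qubits N \<Longrightarrow>
     x = join_label N q a \<longleftrightarrow> prim_label N x = q \<and> anc_label N x = a"
  by (metis anc_label_join join_label_split prim_label_join)

text \<open>Pairs of a primary and an ancillary label correspond bijectively to labels of the whole
  system, so a matrix-vector product can be split by ancillary label.\<close>

lemma sum_over_join_labels:
  "(\<Sum>y < 2 ^ total_qubits N. f y)
     = (\<Sum>a < 2 ^ anc_qubits N. \<Sum>q < 2 ^ prim_qubits N. f (join_label N q a))"
proof -
  have "(\<Sum>y < 2 ^ total_qubits N. f y)
      = (\<Sum>(a, q) \<in> {..<2 ^ anc_qubits N} \<times> {..<2 ^ prim_qubits N}. f (join_label N q a))"
    by (rule sum.reindex_bij_witness[where i = "\<lambda>(a, q). join_label N q a"
          and j = "\<lambda>x. (anc_label N x, prim_label N x)"]) auto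
  then show ?thesis
    by (simp add: sum.cartesian_product)
qed

section \<open>Matrices of basis maps\<close>

lemma basis_map_mat_carrier [simp]: "basis_map_mat m f \<in> carrier_mat (2 ^ m) (2 ^ m)"
  by (simp add: basis_map_mat_def)

lemma dim_basis_map_mat [simp]:
  "dim_row (basis_map_mat m f) = 2 ^ m" "dim_col (basis_map_mat m f) = 2 ^ m"
  by (simp_all add: basis_map_mat_def)

lemma basis_map_mat_cong:
  "(\<And>x. x < 2 ^ m \<Longrightarrow> f x = g x) \<Longrightarrow> basis_map_mat m f = basis_map_mat m g"
  by (auto simp: basis_map_mat_def intro!: eq_matI)

lemma basis_map_mat_id [simp]: "basis_map_mat m id = 1\<^sub>m (2 ^ m)"
  by (auto simp: basis_map_mat_def intro!: eq_matI)

text \<open>The sum over the middle index reduces to \<open>l = g j\<close>, which lies in the range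
  of summation because \<open>g\<close> preserves labels below \<open>2 ^ m\<close>.\<close>

lemma basis_map_mat_mult:
  assumes "basis_preserving m g"
  shows "basis_map_mat m f * basis_map_mat m g = basis_map_mat m (f \<circ> g)"
proof (rule eq_matI)
  fix i j assume ij: "i < dim_row (basis_map_mat m (f \<circ> g))" "j < dim_col (basis_map_mat m (f \<circ> g))"
  then have "(basis_map_mat m f * basis_map_mat m g) $$ (i, j)
    = (\<Sum>l = 0..<2 ^ m. (if i = f l then 1 else 0) * (if l = g j then 1 else 0))"
    by (auto simp: basis_map_mat_def scalar_prod_def intro!: sum.cong)
  also have "\<dots> = (\<Sum>l = 0..<2 ^ m. if l = g j then (if i = f (g j) then 1 else 0) else 0)"
    by (rule sum.cong) auto
  also have "\<dots> = basis_map_mat m (f \<circ> g) $$ (i, j)"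
    using assms ij by (simp add: basis_map_mat_def)
  finally show "(basis_map_mat m f * basis_map_mat m g) $$ (i, j)
      = basis_map_mat m (f \<circ> g) $$ (i, j)" .
qed (auto simp: basis_map_mat_def)

lemma basis_map_mat_apply:
  assumes "v \<in> carrier_vec (2 ^ m)" "x < 2 ^ m"
  shows "(basis_map_mat m f *\<^sub>v v) $ x = (\<Sum>y < 2 ^ m. if x = f y then v $ y else 0)"
  using assms
  by (auto simp: basis_map_mat_def scalar_prod_def atLeast0LessThan intro!: sum.cong)

text \<open>Row \<open>x\<close> collects the labels mapped to \<open>x\<close>; for an involution
  this is \<open>f x\<close> alone.\<close>

lemma basis_map_mat_apply_involution:
  assumes "v \<in> carrier_vec (2 ^ m)" "x < 2 ^ m"
    and "basis_preserving m f" "\<And>y. f (f y) = y"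
  shows "(basis_map_mat m f *\<^sub>v v) $ x = v $ f x"
proof -
  have "(\<Sum>y < 2 ^ m. if x = f y then v $ y else 0) = (\<Sum>y < 2 ^ m. if y = f x then v $ y else 0)"
  proof (rule sum.cong)
    show "(if x = f y then v $ y else 0) = (if y = f x then v $ y else 0)" for y
      using assms(4)[of x] assms(4)[of y] by auto
  qed simp
  then show ?thesis
    using assms by (simp add: basis_map_mat_apply del: index_mult_mat_vec)
qed

section \<open>Basis maps of the primary register selected by the ancillary label\<close>

definition anc_controlled :: "nat \<Rightarrow> (nat \<Rightarrow> nat \<Rightarrow> nat) \<Rightarrow> nat \<Rightarrow> nat" where
  "anc_controlled N F x = join_label N (F (anc_label N x) (prim_label N x)) (anc_label N x)"

definition controlled_mat :: "nat \<Rightarrow> (nat \<Rightarrow> nat \<Rightarrow> nat) \<Rightarrow> complex mat" where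
  "controlled_mat N F = basis_map_mat (total_qubits N) (anc_controlled N F)"

lemma controlled_mat_carrier [simp]:
  "controlled_mat N F \<in> carrier_mat (2 ^ total_qubits N) (2 ^ total_qubits N)"
  by (simp add: controlled_mat_def)

lemma controlled_mat_cong:
  "(\<And>a q. a < 2 ^ anc_qubits N \<Longrightarrow> q < 2 ^ prim_qubits N \<Longrightarrow> F a q = G a q) \<Longrightarrow>
     controlled_mat N F = controlled_mat N G"
  unfolding controlled_mat_def by (rule basis_map_mat_cong) (simp add: anc_controlled_def)

lemma controlled_mat_id: "controlled_mat N (\<lambda>_. id) = 1\<^sub>m (2 ^ total_qubits N)"
proof -
  have "anc_controlled N (\<lambda>_. id) = id"
    by (auto simp: anc_controlled_def)
  then show ?thesis
    by (simp add: controlled_mat_def)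
qed

text \<open>The ancillary label is left alone, so composition takes place separately over each of
  its values; the bound on \<open>G\<close> lets the joined label split again into its two
  parts.\<close>

lemma controlled_mat_mult:
  assumes "\<And>a. basis_preserving (prim_qubits N) (G a)"
  shows "controlled_mat N F * controlled_mat N G = controlled_mat N (\<lambda>a. F a \<circ> G a)"
proof -
  have "basis_preserving (total_qubits N) (anc_controlled N G)"
    using assms by (simp add: anc_controlled_def)
  moreover have "anc_controlled N F \<circ> anc_controlled N G = anc_controlled N (\<lambda>a. F a \<circ> G a)"
    using assms by (auto simp: anc_controlled_def)
  ultimately show ?thesis
    by (simp add: controlled_mat_def basis_map_mat_mult)
qed

text \<open>Turns the entrywise definition of \<open>primary_op\<close> into a basis map, so that
  circuits are multiplied by composing functions.\<close>

lemma primary_op_basis_map_mat: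
  assumes "basis_preserving (prim_qubits N) f"
  shows "primary_op N ctrl (basis_map_mat (prim_qubits N) f)
     = controlled_mat N (\<lambda>a. if control_holds ctrl a then f else id)"
proof (rule eq_matI)
  fix x y assume "x < dim_row (controlled_mat N (\<lambda>a. if control_holds ctrl a then f else id))"
    "y < dim_col (controlled_mat N (\<lambda>a. if control_holds ctrl a then f else id))"
  moreover have "x = y \<longleftrightarrow> anc_label N x = anc_label N y \<and> prim_label N x = prim_label N y"
    using label_eqI by blast
  ultimately show "primary_op N ctrl (basis_map_mat (prim_qubits N) f) $$ (x, y)
      = controlled_mat N (\<lambda>a. if control_holds ctrl a then f else id) $$ (x, y)"
    using assms
    by (auto simp: primary_op_def controlled_mat_def basis_map_mat_def anc_controlled_def
        join_label_eq_iff)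
qed (simp_all add: primary_op_def controlled_mat_def basis_map_mat_def)

lemma primary_op_carrier [simp]:
  "primary_op N ctrl U \<in> carrier_mat (2 ^ total_qubits N) (2 ^ total_qubits N)"
  by (simp add: primary_op_def)

lemma gate_mat_carrier [simp]:
  "gate_mat N g \<in> carrier_mat (2 ^ total_qubits N) (2 ^ total_qubits N)"
  by (cases g) (auto simp: one_qubit_mat_def)

lemma circuit_mat_carrier [simp]:
  "circuit_mat N gs \<in> carrier_mat (2 ^ total_qubits N) (2 ^ total_qubits N)"
  by (induction gs) (auto intro!: mult_carrier_mat[OF _ gate_mat_carrier])

lemma circuit_mat_append:
  "circuit_mat N (gs @ hs) = circuit_mat N hs * circuit_mat N gs"
proof (induction gs)
  case Nil
  show ?case
    by (simp add: right_mult_one_mat[OF circuit_mat_carrier])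
next
  case (Cons g gs)
  then show ?case
    by (simp add: assoc_mult_mat[OF circuit_mat_carrier circuit_mat_carrier gate_mat_carrier])
qed

text \<open>Rows with ancillary label \<open>a\<close> meet only columns with the same label;
  outcome \<open>a\<close> therefore sees \<open>F a\<close> alone, scaled by the amplitude of
  \<open>a\<close>.\<close>

lemma controlled_mat_apply_tensor:
  assumes "\<psi> \<in> carrier_vec (2 ^ prim_qubits N)"
    and "\<And>a. basis_preserving (prim_qubits N) (F a)"
    and a: "a < 2 ^ anc_qubits N"
  shows "outcome_branch N (controlled_mat N F *\<^sub>v tensor_state N \<psi> \<phi>) a
     = \<phi> $ a \<cdot>\<^sub>v (basis_map_mat (prim_qubits N) (F a) *\<^sub>v \<psi>)"
proof (rule eq_vecI)
  fix q assume "q < dim_vec (\<phi> $ a \<cdot>\<^sub>v (basis_map_mat (prim_qubits N) (F a) *\<^sub>v \<psi>))"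
  then have q: "q < 2 ^ prim_qubits N"
    by (simp add: basis_map_mat_def)
  have "outcome_branch N (controlled_mat N F *\<^sub>v tensor_state N \<psi> \<phi>) a $ q
      = (\<Sum>y < 2 ^ total_qubits N. if join_label N q a = anc_controlled N F y
           then tensor_state N \<psi> \<phi> $ y else 0)"
    using q a by (simp add: outcome_branch_def controlled_mat_def basis_map_mat_apply del: index_mult_mat_vec)
  also have "\<dots> = (\<Sum>b < 2 ^ anc_qubits N. \<Sum>r < 2 ^ prim_qubits N.
      if join_label N q a = anc_controlled N F (join_label N r b)
      then tensor_state N \<psi> \<phi> $ join_label N r b else 0)"
    by (rule sum_over_join_labels)
  also have "\<dots> = (\<Sum>b < 2 ^ anc_qubits N. if b = a then
      (\<Sum>r < 2 ^ prim_qubits N. if q = F a r then \<psi> $ r * \<phi> $ a else 0) else 0)"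
  proof (rule sum.cong)
    fix b :: nat assume b: "b \<in> {..<2 ^ anc_qubits N}"
    have "(if join_label N q a = anc_controlled N F (join_label N r b)
        then tensor_state N \<psi> \<phi> $ join_label N r b else 0)
      = (if b = a then if q = F a r then \<psi> $ r * \<phi> $ a else 0 else 0)"
      if r: "r < 2 ^ prim_qubits N" for r
    proof -
      \<comment> \<open>The map keeps the ancillary label, so a match forces \<open>b = a\<close>
        and is then decided in the primary register.\<close>
      have "join_label N q a = join_label N (F b r) b \<longleftrightarrow> b = a \<and> q = F a r"
        using r q assms(2) by (metis anc_label_join prim_label_join)
      then show ?thesis
        using r b q by (simp add: anc_controlled_def tensor_state_def)
    qed
    then show "(\<Sum>r < 2 ^ prim_qubits N.
        if join_label N q a = anc_controlled N F (join_label N r b)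
        then tensor_state N \<psi> \<phi> $ join_label N r b else 0)
      = (if b = a then \<Sum>r < 2 ^ prim_qubits N. if q = F a r then \<psi> $ r * \<phi> $ a else 0 else 0)"
      by simp
  qed simp
  also have "\<dots> = \<phi> $ a * (\<Sum>r < 2 ^ prim_qubits N. if q = F a r then \<psi> $ r else 0)"
    using a by (simp add: sum_distrib_left if_distrib mult.commute cong: if_cong)
  also have "\<dots> = (\<phi> $ a \<cdot>\<^sub>v (basis_map_mat (prim_qubits N) (F a) *\<^sub>v \<psi>)) $ q"
    using q assms(1) basis_map_mat_apply[OF assms(1) q, of "F a"]
    by (simp del: index_mult_mat_vec)
  finally show "outcome_branch N (controlled_mat N F *\<^sub>v tensor_state N \<psi> \<phi>) a $ q
    = (\<phi> $ a \<cdot>\<^sub>v (basis_map_mat (prim_qubits N) (F a) *\<^sub>v \<psi>)) $ q" .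
qed (simp add: outcome_branch_def basis_map_mat_def)

section \<open>Circuits on the primary register\<close>

fun prim_gate_map :: "nat \<Rightarrow> prim_gate \<Rightarrow> nat \<Rightarrow> nat" where
  "prim_gate_map n (PX i) = flip_bit i"
| "prim_gate_map n (PCNOT c t) = cnot_map c t"
| "prim_gate_map n PToffoli = toffoli_map n"

lemma prim_gate_mat_eq: "prim_gate_mat n g = basis_map_mat n (prim_gate_map n g)"
  by (cases g) simp_all

lemma flip_bit_less: "i < m \<Longrightarrow> (x::nat) < 2 ^ m \<Longrightarrow> flip_bit i x < 2 ^ m"
  by (auto simp: less_exp_iff_no_high_bits bit_flip_bit_iff)

lemma flip_bit_flip_bit [simp]: "flip_bit i (flip_bit i x) = (x::nat)"
  by (rule bit_eqI) (auto simp: bit_flip_bit_iff)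

lemma cnot_map_less: "t < m \<Longrightarrow> x < 2 ^ m \<Longrightarrow> cnot_map c t x < 2 ^ m"
  by (simp add: cnot_map_def flip_bit_less)

lemma cnot_map_cnot_map: "c \<noteq> t \<Longrightarrow> cnot_map c t (cnot_map c t x) = x"
  by (simp add: cnot_map_def bit_flip_bit_iff)

lemma toffoli_map_toffoli_map: "toffoli_map n (toffoli_map n x) = x"
  by (auto simp: toffoli_map_def bit_flip_bit_iff)

lemma prim_gate_map_less:
  "0 < n \<Longrightarrow> valid_prim_gate n g \<Longrightarrow> basis_preserving n (prim_gate_map n g)"
  by (cases g) (auto simp: flip_bit_less cnot_map_less toffoli_map_def)

lemma prim_gate_map_involution:
  "valid_prim_gate n g \<Longrightarrow> prim_gate_map n g (prim_gate_map n g x) = x"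
  by (cases g) (auto simp: cnot_map_cnot_map toffoli_map_toffoli_map)

abbreviation prim_circuit_map :: "nat \<Rightarrow> prim_gate list \<Rightarrow> nat \<Rightarrow> nat" where
  "prim_circuit_map n gs \<equiv> fold (prim_gate_map n) gs"

lemma prim_circuit_map_less:
  "0 < n \<Longrightarrow> \<forall>g \<in> set gs. valid_prim_gate n g \<Longrightarrow> basis_preserving n (prim_circuit_map n gs)"
  by (induction gs) (simp_all add: prim_gate_map_less)

text \<open>Each gate is an involution, so the reversed list undoes the gates in turn.\<close>

lemma prim_circuit_map_rev:
  "\<forall>g \<in> set gs. valid_prim_gate n g \<Longrightarrow>
     prim_circuit_map n (rev gs) (prim_circuit_map n gs x) = x"
  by (induction gs arbitrary: x) (simp_all add: prim_gate_map_involution)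

text \<open>All gates share one control, so either the whole list acts or none of it: controlling
  every gate controls the composed map.\<close>

lemma circuit_mat_Prim:
  assumes "0 < prim_qubits N" "\<forall>g \<in> set gs. valid_prim_gate (prim_qubits N) g"
  shows "circuit_mat N (map (Prim ctrl) gs)
     = primary_op N ctrl (basis_map_mat (prim_qubits N) (prim_circuit_map (prim_qubits N) gs))"
proof -
  let ?C = "\<lambda>f a. if control_holds ctrl a then f else (id :: nat \<Rightarrow> nat)"
  have "circuit_mat N (map (Prim ctrl) gs)
     = controlled_mat N (?C (prim_circuit_map (prim_qubits N) gs))"
    using assms(2)
  proof (induction gs)
    case Nil
    have "?C (prim_circuit_map (prim_qubits N) []) = (\<lambda>_. id)"
      by auto
    then show ?case
      by (simp only: controlled_mat_id circuit_mat.simps list.map)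
  next
    case (Cons g gs)
    have less: "basis_preserving (prim_qubits N) (prim_gate_map (prim_qubits N) g)"
      using assms(1) Cons.prems by (simp add: prim_gate_map_less)
    have "circuit_mat N (map (Prim ctrl) (g # gs))
        = controlled_mat N (?C (prim_circuit_map (prim_qubits N) gs))
          * controlled_mat N (?C (prim_gate_map (prim_qubits N) g))"
      using Cons less by (simp add: prim_gate_mat_eq primary_op_basis_map_mat)
    also have "\<dots> = controlled_mat N (\<lambda>a. ?C (prim_circuit_map (prim_qubits N) gs) a
          \<circ> ?C (prim_gate_map (prim_qubits N) g) a)"
      by (rule controlled_mat_mult) (use less in auto)
    also have "\<dots> = controlled_mat N (?C (prim_circuit_map (prim_qubits N) (g # gs)))"
      by (rule controlled_mat_cong) simp
    finally show ?case .
  qed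
  also have "\<dots> = primary_op N ctrl
      (basis_map_mat (prim_qubits N) (prim_circuit_map (prim_qubits N) gs))"
    by (rule primary_op_basis_map_mat[symmetric]) (rule prim_circuit_map_less[OF assms])
  finally show ?thesis .
qed

text \<open>A transposition \<open>(e o')\<close> of an even and an odd label: CNOTs controlled by qubit \<open>0\<close> make
  \<open>o'\<close> agree with \<open>e\<close> on all other qubits, \<open>X\<close> gates turn these qubits into ones, the Toffoli gate
  exchanges the two resulting labels, and the first two steps are undone.\<close>

definition alignment_gates :: "nat \<Rightarrow> nat \<Rightarrow> nat \<Rightarrow> prim_gate list" where
  "alignment_gates n e o' =
     map (PCNOT 0) (filter (\<lambda>i. bit e i \<noteq> bit o' i) [1..<n]) @
     map PX (filter (\<lambda>i. \<not> bit e i) [1..<n])"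

definition transposition_gates :: "nat \<Rightarrow> nat \<Rightarrow> nat \<Rightarrow> prim_gate list" where
  "transposition_gates n e o' =
     alignment_gates n e o' @ PToffoli # rev (alignment_gates n e o')"

lemma alignment_gates_valid: "g \<in> set (alignment_gates n e o') \<Longrightarrow> valid_prim_gate n g"
  by (auto simp: alignment_gates_def)

lemma transposition_gates_valid: "g \<in> set (transposition_gates n e o') \<Longrightarrow> valid_prim_gate n g"
  by (auto simp: transposition_gates_def alignment_gates_valid)

text \<open>Two alignments of at most \<open>2 * n\<close> gates each, with one Toffoli gate in
  between.\<close>

lemma length_transposition_gates: "length (transposition_gates n e o') \<le> 4 * n + 1"
proof -
  have "length (filter P [1..<n]) \<le> n" for P
    using length_filter_le[of P "[1..<n]"] by simp
  then have "length (alignment_gates n e o') \<le> n + n"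
    unfolding alignment_gates_def by (simp add: add_mono del: One_nat_def)
  then show ?thesis
    by (simp add: transposition_gates_def)
qed

text \<open>Qubit 0 is never a target, so every CNOT sees its initial value.\<close>

lemma bit_fold_cnot:
  "distinct is \<Longrightarrow> 0 \<notin> set is \<Longrightarrow>
     bit (fold (cnot_map 0) is x) i \<longleftrightarrow> bit x i \<noteq> (i \<in> set is \<and> bit x 0)"
proof (induction "is" arbitrary: x)
  case (Cons j js)
  then have "j \<noteq> 0" "0 \<notin> set js"
    by auto
  with Cons show ?case
    by (auto simp: cnot_map_def bit_flip_bit_iff)
qed simp

lemma bit_fold_flip:
  "distinct is \<Longrightarrow> bit (fold flip_bit is (x::nat)) i \<longleftrightarrow> bit x i \<noteq> (i \<in> set is)"
  by (induction "is" arbitrary: x) (auto simp: bit_flip_bit_iff)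

text \<open>The inner condition records the CNOTs, the outer one the \<open>X\<close> gates;
  \<open>\<noteq>\<close> between truth values is exclusive or.\<close>

lemma bit_alignment:
  "bit (prim_circuit_map n (alignment_gates n e o') x) i \<longleftrightarrow>
     (bit x i \<noteq> (i \<in> {1..<n} \<and> bit e i \<noteq> bit o' i \<and> bit x 0)) \<noteq> (i \<in> {1..<n} \<and> \<not> bit e i)"
  by (auto simp: alignment_gates_def fold_map comp_def bit_fold_flip bit_fold_cnot)

lemma prim_circuit_map_transposition_gates:
  assumes n: "0 < n" and e: "e < 2 ^ n" "\<not> bit e 0" and o': "o' < 2 ^ n" "bit o' 0"
    and x: "x < 2 ^ n"
  shows "prim_circuit_map n (transposition_gates n e o') x = transpose e o' x"
proof -
  define A where "A = prim_circuit_map n (alignment_gates n e o')"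
  define A' where "A' = prim_circuit_map n (rev (alignment_gates n e o'))"
  have inverse: "A' (A y) = y" for y
    unfolding A_def A'_def by (rule prim_circuit_map_rev) (simp add: alignment_gates_valid)
  have circuit: "prim_circuit_map n (transposition_gates n e o') x = A' (toffoli_map n (A x))"
    by (simp add: transposition_gates_def A_def A'_def)
  have bit_A: "bit (A y) i \<longleftrightarrow>
     (bit y i \<noteq> (i \<in> {1..<n} \<and> bit e i \<noteq> bit o' i \<and> bit y 0)) \<noteq> (i \<in> {1..<n} \<and> \<not> bit e i)"
    for y i unfolding A_def by (rule bit_alignment)
  have high: "\<not> bit y i" if "y < 2 ^ n" "\<not> i < n" for y i :: nat
    using that by (simp add: less_exp_iff_no_high_bits)
  have eqI: "y = z" if "y < 2 ^ n" "z < 2 ^ n" "bit y 0 = bit z 0"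
    "\<forall>i\<in>{1..<n}. bit y i = bit z i" for y z :: nat
  proof (rule bit_eqI)
    fix i show "bit y i = bit z i"
      using that high[of y i] high[of z i] by (cases "i = 0"; cases "i < n") auto
  qed
  \<comment> \<open>Bit 0 decides which label \<open>x\<close> is compared with: an odd
    \<open>x\<close> reaches all ones exactly if it agrees with \<open>o'\<close> on the other
    qubits, an even one if it agrees with \<open>e\<close>.\<close>
  have ones: "(\<forall>i\<in>{1..<n}. bit (A x) i) \<longleftrightarrow> x = e \<or> x = o'"
  proof (cases "bit x 0")
    case True
    then have "(\<forall>i\<in>{1..<n}. bit (A x) i) \<longleftrightarrow> (\<forall>i\<in>{1..<n}. bit x i = bit o' i)"
      by (auto simp: bit_A)
    also have "\<dots> \<longleftrightarrow> x = o'"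
      using eqI[of x o'] True x o' by auto
    finally show ?thesis
      using True e by auto
  next
    case False
    then have "(\<forall>i\<in>{1..<n}. bit (A x) i) \<longleftrightarrow> (\<forall>i\<in>{1..<n}. bit x i = bit e i)"
      by (auto simp: bit_A)
    also have "\<dots> \<longleftrightarrow> x = e"
      using eqI[of x e] False x e by auto
    finally show ?thesis
      using False o' by auto
  qed
  \<comment> \<open>After alignment the two labels differ in qubit 0 only, so the Toffoli gate
    exchanges them.\<close>
  have flip: "flip_bit 0 (A e) = A o'"
  proof (rule bit_eqI)
    fix i show "bit (flip_bit 0 (A e)) i = bit (A o') i"
      using e o' high[of e i] high[of o' i]
      by (cases "i = 0"; cases "i < n") (auto simp: bit_flip_bit_iff bit_A)
  qed
  then have flip': "flip_bit 0 (A o') = A e"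
    by (metis flip_bit_flip_bit)
  show ?thesis
    using ones flip flip' inverse unfolding circuit toffoli_map_def
    by (auto simp: transpose_def)
qed

text \<open>Of two adjacent labels exactly one is even, and \<open>transposition_gates\<close>
  expects that one first.\<close>

definition adj_transp_gates :: "nat \<Rightarrow> nat \<Rightarrow> prim_gate list" where
  "adj_transp_gates n i =
     (if even i then transposition_gates n i (i + 1) else transposition_gates n (i + 1) i)"

lemma prim_circuit_map_adj_transp_gates:
  "0 < n \<Longrightarrow> i + 1 < 2 ^ n \<Longrightarrow> x < 2 ^ n \<Longrightarrow>
     prim_circuit_map n (adj_transp_gates n i) x = adj_transp i x"
  unfolding adj_transp_gates_def adj_transp_def
  by (cases "even i") (simp_all add: prim_circuit_map_transposition_gates bit_0 transpose_commute)

text \<open>Gates are listed in order of application, so the rightmost factor of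
  \<open>Pi_elem k (Suc j)\<close> comes at the head.\<close>

primrec Pi_gates :: "nat \<Rightarrow> nat \<Rightarrow> nat \<Rightarrow> prim_gate list" where
  "Pi_gates n k 0 = []"
| "Pi_gates n k (Suc j) = adj_transp_gates n (k - j) @ Pi_gates n k j"

lemma Pi_gates_valid: "g \<in> set (Pi_gates n k j) \<Longrightarrow> valid_prim_gate n g"
  by (induction j)
    (auto simp: adj_transp_gates_def transposition_gates_valid split: if_splits)

lemma length_Pi_gates: "length (Pi_gates n k j) \<le> j * (4 * n + 1)"
proof (induction j)
  case (Suc j)
  have "length (adj_transp_gates n (k - j)) \<le> 4 * n + 1"
    unfolding adj_transp_gates_def by (simp only: length_transposition_gates split: if_split) simp
  then show ?case
    using Suc by simp
qed simp

lemma adj_transp_permutes: "i + 1 < m \<Longrightarrow> adj_transp i permutes {..<m}"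
  unfolding adj_transp_def by (rule permutes_swap_id) auto

text \<open>The truncated difference \<open>k - j\<close> never exceeds \<open>k\<close>, so for
  every \<open>j\<close> the factors move only labels up to \<open>k + 1\<close>.\<close>

lemma Pi_elem_permutes: "k + 1 < m \<Longrightarrow> Pi_elem k j permutes {..<m}"
  by (induction j) (auto intro!: permutes_compose adj_transp_permutes simp: permutes_id)

lemma prim_circuit_map_Pi_gates:
  assumes n: "0 < n" and k: "k + 1 < 2 ^ n" and x: "x < 2 ^ n"
  shows "prim_circuit_map n (Pi_gates n k j) x = Pi_elem k j x"
  using x
proof (induction j arbitrary: x)
  case (Suc j)
  have "k - j + 1 < 2 ^ n"
    using k by simp
  moreover have "adj_transp (k - j) x < 2 ^ n"
    using permutes_in_image[OF adj_transp_permutes[OF \<open>k - j + 1 < 2 ^ n\<close>], of x] Suc.prems by simp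
  ultimately show ?case
    using Suc n by (simp add: prim_circuit_map_adj_transp_gates)
qed simp

lemma less_exp_prim_qubits: "N \<le> 2 ^ prim_qubits N"
proof (cases "N = 0")
  case False
  then have "log 2 (real N) \<le> real (prim_qubits N)"
    unfolding prim_qubits_def by linarith
  then have "real N \<le> 2 powr real (prim_qubits N)"
    using False by (simp add: log_le_iff)
  then have "real N \<le> real (2 ^ prim_qubits N)"
    by (simp add: powr_realpow)
  then show ?thesis
    by (simp only: of_nat_le_iff)
qed simp

lemma prim_qubits_pos: "1 < N \<Longrightarrow> 0 < prim_qubits N"
  using less_exp_prim_qubits[of N] by (cases "prim_qubits N = 0") auto

definition Pi_block :: "nat \<Rightarrow> nat \<Rightarrow> nat \<Rightarrow> gate list" where
  "Pi_block N k j = map (Prim (Some (k, j))) (Pi_gates (prim_qubits N) k j)"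

lemma Pi_block_primary:
  "k < N - 1 \<Longrightarrow> j \<le> k + 1 \<Longrightarrow> g \<in> set (Pi_block N k j) \<Longrightarrow> primary_gate N g"
  by (auto simp: Pi_block_def Pi_gates_valid)

lemma circuit_mat_Pi_block:
  assumes k: "k < N - 1"
  shows "circuit_mat N (Pi_block N k j)
     = primary_op N (Some (k, j)) (basis_map_mat (prim_qubits N) (Pi_elem k j))"
proof -
  have "k + 1 < 2 ^ prim_qubits N"
    using k less_exp_prim_qubits[of N] by simp
  moreover have "0 < prim_qubits N"
    using k by (intro prim_qubits_pos) simp
  ultimately have "basis_map_mat (prim_qubits N)
      (prim_circuit_map (prim_qubits N) (Pi_gates (prim_qubits N) k j))
    = basis_map_mat (prim_qubits N) (Pi_elem k j)"
    by (intro basis_map_mat_cong) (simp add: prim_circuit_map_Pi_gates)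
  then show ?thesis
    unfolding Pi_block_def using \<open>0 < prim_qubits N\<close>
    by (subst circuit_mat_Prim) (auto simp: Pi_gates_valid)
qed

section \<open>Circuits on the ancillary register\<close>

text \<open>Amplitudes are functions on all natural numbers, so that no ranges of labels need to be tracked;
  the value on \<open>Prim\<close> gates is junk.\<close>

fun anc_action :: "gate \<Rightarrow> (nat \<Rightarrow> complex) \<Rightarrow> nat \<Rightarrow> complex" where
  "anc_action (AncU i U) f = (\<lambda>a. U $$ (of_bool (bit a i), 0) * f (unset_bit i a)
     + U $$ (of_bool (bit a i), 1) * f (set_bit i a))"
| "anc_action (AncCNOT c t) f = f \<circ> cnot_map c t"
| "anc_action (Prim ctrl g) f = f"

section \<open>Action of single ancillary gates on amplitudes\<close>

lemma set_bit_less: "i < m \<Longrightarrow> (x::nat) < 2 ^ m \<Longrightarrow> set_bit i x < 2 ^ m"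
  by (auto simp: less_exp_iff_no_high_bits bit_set_bit_iff)

lemma unset_bit_less: "(x::nat) < 2 ^ m \<Longrightarrow> unset_bit i x < 2 ^ m"
  by (auto simp: less_exp_iff_no_high_bits bit_unset_bit_iff)

text \<open>The fibres of \<open>unset_bit i\<close> have two elements, which is why at most two
  entries in a row of \<open>one_qubit_mat\<close> are nonzero.\<close>

lemma unset_bit_eq_iff:
  "unset_bit i x = unset_bit i y \<longleftrightarrow> y = unset_bit i x \<or> y = set_bit i (x :: nat)"
proof
  assume eq: "unset_bit i x = unset_bit i y"
  have other: "bit y j \<longleftrightarrow> bit x j" if "j \<noteq> i" for j
    using arg_cong[OF eq, of "\<lambda>z. bit z j"] that by (simp add: bit_unset_bit_iff)
  have "y = (if bit y i then set_bit i x else unset_bit i x)"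
  proof (rule bit_eqI)
    fix j show "bit y j = bit (if bit y i then set_bit i x else unset_bit i x) j"
      using other[of j] by (cases "j = i") (auto simp: bit_unset_bit_iff bit_set_bit_iff)
  qed
  then show "y = unset_bit i x \<or> y = set_bit i x"
    by metis
next
  assume "y = unset_bit i x \<or> y = set_bit i x"
  then show "unset_bit i x = unset_bit i y"
    by (auto intro!: bit_eqI simp: bit_unset_bit_iff bit_set_bit_iff)
qed

lemma prim_label_shifted_bit [simp]:
  "prim_label N (set_bit (prim_qubits N + i) x) = prim_label N x"
  "prim_label N (unset_bit (prim_qubits N + i) x) = prim_label N x"
  "prim_label N (flip_bit (prim_qubits N + i) x) = prim_label N x"
  by (auto intro!: bit_eqI
      simp: prim_label_def bit_take_bit_iff bit_set_bit_iff bit_unset_bit_iff bit_flip_bit_iff)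

lemma anc_label_shifted_bit [simp]:
  "anc_label N (set_bit (prim_qubits N + i) x) = set_bit i (anc_label N x)"
  "anc_label N (unset_bit (prim_qubits N + i) x) = unset_bit i (anc_label N x)"
  "anc_label N (flip_bit (prim_qubits N + i) x) = flip_bit i (anc_label N x)"
  by (auto intro!: bit_eqI
      simp: anc_label_def bit_drop_bit_eq bit_set_bit_iff bit_unset_bit_iff bit_flip_bit_iff)

lemma bit_anc_label: "bit (anc_label N x) i \<longleftrightarrow> bit x (prim_qubits N + i)"
  by (simp add: anc_label_def bit_drop_bit_eq)

lemma one_qubit_mat_apply:
  assumes i: "i < m" and x: "x < 2 ^ m" and v: "v \<in> carrier_vec (2 ^ m)"
  shows "(one_qubit_mat m i U *\<^sub>v v) $ x
    = U $$ (of_bool (bit x i), 0) * v $ unset_bit i x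
      + U $$ (of_bool (bit x i), 1) * v $ set_bit i x"
proof -
  let ?t = "\<lambda>y. U $$ (of_bool (bit x i), of_bool (bit y i)) * v $ y"
  have "(one_qubit_mat m i U *\<^sub>v v) $ x
      = (\<Sum>y < 2 ^ m. (if unset_bit i x = unset_bit i y
          then U $$ (of_bool (bit x i), of_bool (bit y i)) else 0) * v $ y)"
    using x v by (simp add: one_qubit_mat_def scalar_prod_def atLeast0LessThan)
  also have "\<dots> = (\<Sum>y \<in> {unset_bit i x, set_bit i x}. ?t y)"
    by (rule sum.mono_neutral_cong_right)
      (use i x in \<open>auto simp: set_bit_less unset_bit_less unset_bit_eq_iff[of i x]\<close>)
  also have "\<dots> = ?t (unset_bit i x) + ?t (set_bit i x)"
  proof -
    have "bit (unset_bit i x) i \<noteq> bit (set_bit i x) i"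
      by (simp add: bit_unset_bit_iff bit_set_bit_iff)
    then show ?thesis
      by (subst sum.insert) auto
  qed
  finally show ?thesis
    by (simp add: bit_unset_bit_iff bit_set_bit_iff)
qed

text \<open>The gate touches only bits beyond the primary register, so the primary factor passes
  through unchanged and the product form persists.\<close>

lemma gate_mat_apply_tensor:
  assumes g: "ancillary_gate N g"
  shows "gate_mat N g *\<^sub>v tensor_state N \<psi> (vec (2 ^ anc_qubits N) f)
    = tensor_state N \<psi> (vec (2 ^ anc_qubits N) (anc_action g f))" (is "?L = ?R")
proof (rule eq_vecI)
  show "dim_vec ?L = dim_vec ?R"
    by (simp add: carrier_matD(1)[OF gate_mat_carrier] carrier_vecD[OF tensor_state_carrier])
  fix x assume "x < dim_vec ?R"
  then have x: "x < 2 ^ total_qubits N"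
    by (simp add: tensor_state_def)
  have entry: "tensor_state N \<psi> (vec (2 ^ anc_qubits N) h) $ y
      = \<psi> $ prim_label N y * h (anc_label N y)" if "y < 2 ^ total_qubits N" for h y
    using that by (simp add: tensor_state_def)
  show "?L $ x = ?R $ x"
  proof (cases g)
    case (AncU i U)
    then have i: "prim_qubits N + i < total_qubits N"
      using g by (simp add: total_qubits_def)
    show ?thesis
      unfolding AncU gate_mat.simps one_qubit_mat_apply[OF i x tensor_state_carrier]
      using i x by (simp add: entry set_bit_less unset_bit_less bit_anc_label distrib_left mult.left_commute)
  next
    case (AncCNOT c t)
    let ?h = "cnot_map (prim_qubits N + c) (prim_qubits N + t)"
    have "basis_preserving (total_qubits N) ?h" "\<And>y. ?h (?h y) = y"
      using AncCNOT g by (simp_all add: cnot_map_less cnot_map_cnot_map total_qubits_def)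
    moreover have "prim_label N (?h x) = prim_label N x"
      "anc_label N (?h x) = cnot_map c t (anc_label N x)"
      by (simp_all add: cnot_map_def bit_anc_label)
    ultimately show ?thesis
      using x AncCNOT basis_map_mat_apply_involution[OF tensor_state_carrier x, of ?h]
      by (simp add: entry del: index_mult_mat_vec)
  next
    case (Prim ctrl p)
    then show ?thesis
      using g by simp
  qed
qed

lemma circuit_mat_apply_tensor:
  "\<forall>g \<in> set gs. ancillary_gate N g \<Longrightarrow>
     circuit_mat N gs *\<^sub>v tensor_state N \<psi> (vec (2 ^ anc_qubits N) f)
       = tensor_state N \<psi> (vec (2 ^ anc_qubits N) (fold anc_action gs f))"
proof (induction gs arbitrary: f)
  case Nil
  show ?case
    by simp
next
  case (Cons g gs)
  then show ?case
    by (simp add: gate_mat_apply_tensor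
        assoc_mult_mat_vec[OF circuit_mat_carrier gate_mat_carrier tensor_state_carrier])
qed

subsection \<open>Multiplexed rotations\<close>

definition rotation_mat :: "real \<Rightarrow> complex mat" where
  "rotation_mat t = mat 2 2 (\<lambda>(i, j). if i = j then complex_of_real (cos t)
     else if i = 0 then - complex_of_real (sin t) else complex_of_real (sin t))"

lemma rotation_mat_carrier: "rotation_mat t \<in> carrier_mat 2 2"
  by (simp add: rotation_mat_def)

lemma rotation_mat_unitary: "rotation_mat t * mat_adjoint (rotation_mat t) = 1\<^sub>m 2"
proof -
  have "complex_of_real (cos t) * complex_of_real (cos t)
      + complex_of_real (sin t) * complex_of_real (sin t) = 1"
    by (metis sin_cos_squared_add3 of_real_1 of_real_add of_real_mult)
  then show ?thesis
    by (auto intro!: eq_matI simp: rotation_mat_def mat_adjoint_def scalar_prod_def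
        mat_of_rows_def numeral_2_eq_2 less_Suc_eq add.commute)
qed

text \<open>The intended effect of a multiplexed rotation on amplitudes; where it is applied, the
  angle does not depend on bit \<open>t\<close>.\<close>

definition rotate :: "nat \<Rightarrow> (nat \<Rightarrow> real) \<Rightarrow> (nat \<Rightarrow> complex) \<Rightarrow> nat \<Rightarrow> complex" where
  "rotate t \<theta> f a = (if bit a t
     then complex_of_real (sin (\<theta> a)) * f (unset_bit t a) + complex_of_real (cos (\<theta> a)) * f a
     else complex_of_real (cos (\<theta> a)) * f a - complex_of_real (sin (\<theta> a)) * f (set_bit t a))"

text \<open>A rotation of qubit \<open>t\<close> by the angle \<open>\<theta> a\<close>, where \<open>\<theta> a\<close> is determined by the bits of \<open>a\<close> in the
  list: splitting off one of these bits \<open>c\<close>, the mean of the two angles is always applied, and half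
  their difference is applied with a sign that depends on bit \<open>c\<close>, since conjugation with \<open>X\<close>
  inverts a rotation.\<close>

primrec multiplexed_rotation :: "nat \<Rightarrow> nat list \<Rightarrow> (nat \<Rightarrow> real) \<Rightarrow> gate list" where
  "multiplexed_rotation t [] \<theta> = [AncU t (rotation_mat (\<theta> 0))]"
| "multiplexed_rotation t (c # cs) \<theta> =
     AncCNOT c t #
     multiplexed_rotation t cs (\<lambda>a. (\<theta> (unset_bit c a) - \<theta> (set_bit c a)) / 2) @
     AncCNOT c t #
     multiplexed_rotation t cs (\<lambda>a. (\<theta> (unset_bit c a) + \<theta> (set_bit c a)) / 2)"

text \<open>The lengths satisfy \<open>L 0 = 1\<close> and \<open>L (c + 1) = 2 * L c + 2\<close>,
  with solution \<open>3 * 2 ^ c - 2\<close>.\<close>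

lemma length_multiplexed_rotation: "length (multiplexed_rotation t cs \<theta>) \<le> 3 * 2 ^ length cs - 2"
proof (induction cs arbitrary: \<theta>)
  case (Cons c cs)
  note Cons[of "\<lambda>a. (\<theta> (unset_bit c a) - \<theta> (set_bit c a)) / 2"]
    Cons[of "\<lambda>a. (\<theta> (unset_bit c a) + \<theta> (set_bit c a)) / 2"]
  moreover have "(2::nat) ^ length cs \<ge> 1"
    by simp
  ultimately show ?case
    unfolding multiplexed_rotation.simps list.size length_append add_Suc_right add_0_right power_Suc
    by linarith
qed simp

lemma multiplexed_rotation_ancillary:
  "\<forall>c \<in> set cs. c < anc_qubits N \<and> c \<noteq> t \<Longrightarrow> t < anc_qubits N \<Longrightarrow>
     g \<in> set (multiplexed_rotation t cs \<theta>) \<Longrightarrow> ancillary_gate N g"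
  by (induction cs arbitrary: \<theta>) (auto simp: rotation_mat_carrier rotation_mat_unitary)

lemma unset_bit_idle: "\<not> bit a i \<Longrightarrow> unset_bit i a = (a::nat)"
  by (rule bit_eqI) (metis bit_unset_bit_iff)

lemma set_bit_idle: "bit a i \<Longrightarrow> set_bit i a = (a::nat)"
  by (rule bit_eqI) (metis bit_set_bit_iff possible_bit_nat)

lemma flip_bit_eq_set_unset: "flip_bit i (a::nat) = (if bit a i then unset_bit i a else set_bit i a)"
proof (rule bit_eqI)
  fix n show "bit (flip_bit i a) n = bit (if bit a i then unset_bit i a else set_bit i a) n"
    by (cases "n = i") (simp_all add: bit_flip_bit_iff bit_unset_bit_iff bit_set_bit_iff)
qed

lemma anc_action_rotation: "anc_action (AncU t (rotation_mat s)) f = rotate t (\<lambda>_. s) f"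
  by (rule ext) (auto simp: rotate_def rotation_mat_def unset_bit_idle set_bit_idle)

lemma set_bit_set_bit [simp]: "set_bit i (set_bit i (a::nat)) = set_bit i a"
  "set_bit i (unset_bit i a) = set_bit i a" "unset_bit i (set_bit i a) = unset_bit i a"
  "unset_bit i (unset_bit i a) = unset_bit i a"
  by (auto intro!: bit_eqI simp: bit_set_bit_iff bit_unset_bit_iff)

lemma rotate_unset_bit:
  "rotate t \<theta> f (unset_bit t a) = complex_of_real (cos (\<theta> (unset_bit t a))) * f (unset_bit t a)
     - complex_of_real (sin (\<theta> (unset_bit t a))) * f (set_bit t a)"
  by (simp add: rotate_def bit_unset_bit_iff)

lemma rotate_set_bit:
  "rotate t \<theta> f (set_bit t a) = complex_of_real (sin (\<theta> (set_bit t a))) * f (unset_bit t a)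
     + complex_of_real (cos (\<theta> (set_bit t a))) * f (set_bit t a)"
  by (simp add: rotate_def bit_set_bit_iff)

lemma cnot_map_target_bit:
  assumes "c \<noteq> t"
  shows "cnot_map c t (unset_bit t a) = (if bit a c then set_bit t a else unset_bit t a)"
    and "cnot_map c t (set_bit t a) = (if bit a c then unset_bit t a else set_bit t a)"
  using assms by (simp_all add: cnot_map_def bit_unset_bit_iff bit_set_bit_iff flip_bit_eq_set_unset)

lemma fold_multiplexed_rotation:
  assumes "t \<notin> set cs"
    and "\<And>a b. (\<And>c. c \<in> set cs \<Longrightarrow> bit a c = bit b c) \<Longrightarrow> \<theta> a = \<theta> b"
  shows "fold anc_action (multiplexed_rotation t cs \<theta>) f = rotate t \<theta> f"
  using assms
proof (induction cs arbitrary: \<theta> f)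
  case Nil
  \<comment> \<open>Without controls the angle is constant, so its value at label 0 represents
    it.\<close>
  have "(\<lambda>_. \<theta> 0) = \<theta>"
    by (rule ext) (rule Nil.prems(2), simp)
  then show ?case
    by (simp only: multiplexed_rotation.simps fold_simps anc_action_rotation)
next
  case (Cons c cs)
  define d where "d a = (\<theta> (unset_bit c a) - \<theta> (set_bit c a)) / 2" for a
  define m where "m a = (\<theta> (unset_bit c a) + \<theta> (set_bit c a)) / 2" for a
  have ct: "c \<noteq> t" "t \<notin> set cs"
    using Cons.prems(1) by auto
  have \<theta>: "\<theta> a = \<theta> b" if "bit a c = bit b c" "\<And>i. i \<in> set cs \<Longrightarrow> bit a i = bit b i" for a b
    by (rule Cons.prems(2)) (use that in auto)
  have d_cong: "d a = d b" and m_cong: "m a = m b"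
    if eq: "\<And>i. i \<in> set cs \<Longrightarrow> bit a i = bit b i" for a b
  proof -
    have "\<theta> (unset_bit c a) = \<theta> (unset_bit c b)"
      by (rule \<theta>) (simp_all add: bit_unset_bit_iff eq)
    moreover have "\<theta> (set_bit c a) = \<theta> (set_bit c b)"
      by (rule \<theta>) (simp_all add: bit_set_bit_iff eq)
    ultimately show "d a = d b" "m a = m b"
      by (simp_all only: d_def m_def)
  qed
  have d: "fold anc_action (multiplexed_rotation t cs d) h = rotate t d h" for h
    by (rule Cons.IH[OF ct(2) d_cong])
  have m: "fold anc_action (multiplexed_rotation t cs m) h = rotate t m h" for h
    by (rule Cons.IH[OF ct(2) m_cong])
  \<comment> \<open>The mean \<open>m\<close> is always applied; the part \<open>d\<close> between
    the CNOTs counts negatively where bit \<open>c\<close> is set.\<close>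
  have \<theta>_eq: "\<theta> a = (if bit a c then m a - d a else m a + d a)" for a
  proof (cases "bit a c")
    case True
    then show ?thesis
      by (simp add: m_def d_def set_bit_idle field_simps)
  next
    case False
    then show ?thesis
      by (simp add: m_def d_def unset_bit_idle field_simps)
  qed
  define D where "D = rotate t d (f \<circ> cnot_map c t) \<circ> cnot_map c t"
  \<comment> \<open>Every label belongs to a pair differing in bit \<open>t\<close> only. Both
    members share their angles, and the addition formulas merge the two rotations into one.\<close>
  have both: "rotate t m D (unset_bit t a) = rotate t \<theta> f (unset_bit t a) \<and>
      rotate t m D (set_bit t a) = rotate t \<theta> f (set_bit t a)" for a
  proof -
    have t_idle: "d (set_bit t a) = d (unset_bit t a)" "m (set_bit t a) = m (unset_bit t a)"
      by (rule d_cong m_cong; use ct in \<open>auto simp: bit_unset_bit_iff bit_set_bit_iff\<close>)+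
    have bits: "bit (set_bit t a) c = bit a c" "bit (unset_bit t a) c = bit a c"
      using ct by (simp_all add: bit_unset_bit_iff bit_set_bit_iff)
    show ?thesis
    proof (cases "bit a c")
      case True
      show ?thesis
        by (simp only: D_def rotate_unset_bit rotate_set_bit comp_apply cnot_map_target_bit[OF ct(1)]
            \<theta>_eq bits t_idle True if_True)
          (simp add: sin_diff cos_diff algebra_simps)
    next
      case False
      show ?thesis
        by (simp only: D_def rotate_unset_bit rotate_set_bit comp_apply cnot_map_target_bit[OF ct(1)]
            \<theta>_eq bits t_idle False if_False)
          (simp add: sin_add cos_add algebra_simps)
    qed
  qed
  have "rotate t m D a = rotate t \<theta> f a" for a
    using both[of a] by (cases "bit a t") (simp_all add: set_bit_idle unset_bit_idle)
  then have "rotate t m (rotate t d (f \<circ> cnot_map c t) \<circ> cnot_map c t) = rotate t \<theta> f"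
    unfolding D_def by (rule ext)
  moreover have "multiplexed_rotation t (c # cs) \<theta>
      = AncCNOT c t # multiplexed_rotation t cs d @ AncCNOT c t # multiplexed_rotation t cs m"
    unfolding multiplexed_rotation.simps d_def m_def by (rule refl)
  ultimately show ?case
    by (simp only: fold_append fold_simps comp_apply anc_action.simps d m)
qed

subsection \<open>Preparation of a distribution on one ancillary system\<close>

text \<open>The total weight of the labels whose leading bits, from bit \<open>i\<close> on, form the number \<open>h\<close>.\<close>

primrec subtree_weight :: "(nat \<Rightarrow> real) \<Rightarrow> nat \<Rightarrow> nat \<Rightarrow> real" where
  "subtree_weight p 0 h = p h"
| "subtree_weight p (Suc i) h = subtree_weight p i (2 * h) + subtree_weight p i (2 * h + 1)"

lemma subtree_weight_nonneg: "(\<And>y. 0 \<le> p y) \<Longrightarrow> 0 \<le> subtree_weight p i h"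
  by (induction i arbitrary: h) simp_all

lemma subtree_weight_eq_sum: "subtree_weight p i h = (\<Sum>y < 2 ^ i. p (h * 2 ^ i + y))"
proof (induction i arbitrary: h)
  case (Suc i)
  have "(\<Sum>y < 2 ^ Suc i. p (h * 2 ^ Suc i + y))
      = (\<Sum>y < 2 ^ i + 2 ^ i. p (h * 2 ^ Suc i + y))"
    by (simp add: mult_2)
  also have "\<dots> = (\<Sum>y < 2 ^ i. p (h * 2 ^ Suc i + y)) + (\<Sum>y < 2 ^ i. p (h * 2 ^ Suc i + (2 ^ i + y)))"
    using sum.shift_bounds_nat_ivl[of "\<lambda>y. p (h * 2 ^ Suc i + y)" 0 "2 ^ i" "2 ^ i"]
      sum.atLeastLessThan_concat[of 0 "2 ^ i" "2 ^ i + 2 ^ i" "\<lambda>y. p (h * 2 ^ Suc i + y)"]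
    by (simp add: atLeast0LessThan add.commute)
  also have "\<dots> = subtree_weight p (Suc i) h"
    by (simp add: Suc algebra_simps)
  finally show ?case ..
qed simp

definition split_angle :: "real \<Rightarrow> real \<Rightarrow> real" where
  "split_angle x y = arccos (sqrt (x / (x + y)))"

text \<open>The squares of cosine and sine are the shares of \<open>x\<close> and \<open>y\<close>
  in \<open>x + y\<close>. If the sum is zero, both weights vanish and the default value of the
  division does no harm.\<close>

lemma split_angle:
  assumes "0 \<le> x" "0 \<le> y"
  shows "cos (split_angle x y) * sqrt (x + y) = sqrt x"
    and "sin (split_angle x y) * sqrt (x + y) = sqrt y"
proof -
  have range: "0 \<le> x / (x + y)" "x / (x + y) \<le> 1"
    using assms by (auto simp: divide_le_eq_1)
  then have root: "- 1 \<le> sqrt (x / (x + y))" "sqrt (x / (x + y)) \<le> 1"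
    using real_sqrt_ge_zero[OF range(1)] by (linarith, simp)
  show "cos (split_angle x y) * sqrt (x + y) = sqrt x"
    unfolding split_angle_def cos_arccos[OF root] real_sqrt_mult[symmetric]
    using assms by (cases "x + y = 0") simp_all
  have "sin (split_angle x y) = sqrt (1 - x / (x + y))"
    unfolding split_angle_def sin_arccos[OF root] real_sqrt_pow2[OF range(1)] by (rule refl)
  moreover have "(1 - x / (x + y)) * (x + y) = y" if "x + y \<noteq> 0"
    using that by (simp add: field_simps)
  ultimately show "sin (split_angle x y) * sqrt (x + y) = sqrt y"
    using assms by (cases "x + y = 0") (simp_all add: real_sqrt_mult[symmetric])
qed

definition tree_angle :: "(nat \<Rightarrow> real) \<Rightarrow> nat \<Rightarrow> nat \<Rightarrow> real" where
  "tree_angle p i h = split_angle (subtree_weight p i (2 * h)) (subtree_weight p i (2 * h + 1))"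

lemma tree_angle:
  assumes "\<And>y. 0 \<le> p y"
  shows "complex_of_real (cos (tree_angle p i h)) * complex_of_real (sqrt (subtree_weight p (Suc i) h))
      = complex_of_real (sqrt (subtree_weight p i (2 * h)))"
    and "complex_of_real (sin (tree_angle p i h)) * complex_of_real (sqrt (subtree_weight p (Suc i) h))
      = complex_of_real (sqrt (subtree_weight p i (2 * h + 1)))"
  using split_angle[OF subtree_weight_nonneg[of p i "2 * h"] subtree_weight_nonneg[of p i "2 * h + 1"]]
    assms
  unfolding tree_angle_def subtree_weight.simps(2) of_real_mult[symmetric] by simp_all

text \<open>The amplitude of \<open>y\<close> once the qubits of index \<open>i\<close> and above have been treated.\<close>

definition tree_amp :: "(nat \<Rightarrow> real) \<Rightarrow> nat \<Rightarrow> nat \<Rightarrow> complex" where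
  "tree_amp p i y =
     (if take_bit i y = 0 then complex_of_real (sqrt (subtree_weight p i (drop_bit i y))) else 0)"

text \<open>\<open>b\<close> is the offset of the system and \<open>m\<close> its number of qubits.
  The controls are the qubits of the system above qubit \<open>i\<close>, whose bits form the tree
  node to be split.\<close>

definition tree_step :: "(nat \<Rightarrow> real) \<Rightarrow> nat \<Rightarrow> nat \<Rightarrow> nat \<Rightarrow> gate list" where
  "tree_step p b m i = multiplexed_rotation (b + i) [b + Suc i..<b + m]
     (\<lambda>a. tree_angle p i (drop_bit (Suc i) (take_bit m (drop_bit b a))))"

text \<open>The leading qubits come first, as the angles for a qubit are read off those above
  it.\<close>

definition tree_gates :: "(nat \<Rightarrow> real) \<Rightarrow> nat \<Rightarrow> nat \<Rightarrow> gate list" where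
  "tree_gates p b m = concat (map (tree_step p b m) (rev [0..<m]))"

section \<open>Bits of a label at and around the target qubit\<close>

lemma take_drop_bit_target:
  assumes "i < m"
  shows "take_bit m (drop_bit b (set_bit (b + i) a)) = set_bit i (take_bit m (drop_bit b (a :: nat)))"
    and "take_bit m (drop_bit b (unset_bit (b + i) a)) = unset_bit i (take_bit m (drop_bit b a))"
  using assms
  by (auto intro!: bit_eqI simp: bit_take_bit_iff bit_drop_bit_eq bit_set_bit_iff bit_unset_bit_iff)

lemma drop_bit_Suc_target:
  "drop_bit (Suc i) (set_bit i (y :: nat)) = drop_bit (Suc i) y"
  "drop_bit (Suc i) (unset_bit i y) = drop_bit (Suc i) y"
  by (auto intro!: bit_eqI simp: bit_drop_bit_eq bit_set_bit_iff bit_unset_bit_iff)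

lemma drop_bit_eq_double: "drop_bit i (y :: nat) = 2 * drop_bit (Suc i) y + of_bool (bit y i)"
proof -
  have "y div 2 ^ i = 2 * (y div 2 ^ i div 2) + y div 2 ^ i mod 2"
    by simp
  then show ?thesis
    by (simp only: drop_bit_eq_div power_Suc2 div_mult2_eq bit_iff_odd mod_2_eq_odd)
qed

lemma drop_bit_target:
  "drop_bit i (set_bit i (y :: nat)) = 2 * drop_bit (Suc i) y + 1"
  "drop_bit i (unset_bit i y) = 2 * drop_bit (Suc i) y"
  by (simp_all only: drop_bit_eq_double[of i "set_bit i y"] drop_bit_eq_double[of i "unset_bit i y"]
      drop_bit_Suc_target) (simp_all add: bit_set_bit_iff bit_unset_bit_iff)

lemma take_bit_target:
  "take_bit i (set_bit i (y :: nat)) = take_bit i y"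
  "take_bit i (unset_bit i y) = take_bit i y"
  "take_bit (Suc i) (unset_bit i y) = take_bit i y"
  by (auto intro!: bit_eqI simp: bit_take_bit_iff bit_set_bit_iff bit_unset_bit_iff less_Suc_eq)

lemma take_bit_Suc_set_bit: "take_bit (Suc i) (set_bit i (y :: nat)) \<noteq> 0"
proof
  assume "take_bit (Suc i) (set_bit i y) = 0"
  then have "bit (take_bit (Suc i) (set_bit i y)) i = bit (0 :: nat) i"
    by (rule arg_cong)
  then show False
    by (simp add: bit_take_bit_iff bit_set_bit_iff)
qed

text \<open>The rotation divides the amplitude of a node \<open>h\<close> between its children
  \<open>2 * h\<close> and \<open>2 * h + 1\<close>. The factor \<open>F\<close> stands for the
  other systems, which these qubits do not affect.\<close>

lemma fold_tree_step:
  assumes p: "\<And>y. 0 \<le> p y" and i: "i < m"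
    and F: "\<And>a t. t \<in> {b..<b + m} \<Longrightarrow> F (set_bit t a) = F a \<and> F (unset_bit t a) = F a"
  shows "fold anc_action (tree_step p b m i)
      (\<lambda>a. F a * tree_amp p (Suc i) (take_bit m (drop_bit b a)))
    = (\<lambda>a. F a * tree_amp p i (take_bit m (drop_bit b a)))"
proof -
  define \<theta> where "\<theta> a = tree_angle p i (drop_bit (Suc i) (take_bit m (drop_bit b a)))" for a
  define f where "f a = F a * tree_amp p (Suc i) (take_bit m (drop_bit b a))" for a
  let ?g = "\<lambda>a. F a * tree_amp p i (take_bit m (drop_bit b a))"
  have dep: "\<theta> a = \<theta> a'" if eq: "\<And>c. c \<in> set [b + Suc i..<b + m] \<Longrightarrow> bit a c = bit a' c" for a a'
  proof -
    have "drop_bit (Suc i) (take_bit m (drop_bit b a)) = drop_bit (Suc i) (take_bit m (drop_bit b a'))"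
    proof (rule bit_eqI)
      fix n
      have "bit a (b + (Suc i + n)) = bit a' (b + (Suc i + n))" if "Suc i + n < m"
        by (rule eq) (use that in simp)
      then show "bit (drop_bit (Suc i) (take_bit m (drop_bit b a))) n
          = bit (drop_bit (Suc i) (take_bit m (drop_bit b a'))) n"
        by (auto simp: bit_drop_bit_eq bit_take_bit_iff)
    qed
    then show ?thesis
      by (simp only: \<theta>_def)
  qed
  have "fold anc_action (tree_step p b m i) f = rotate (b + i) \<theta> f"
    unfolding tree_step_def \<theta>_def[symmetric]
    by (rule fold_multiplexed_rotation) (simp, rule dep)
  moreover have both: "rotate (b + i) \<theta> f (unset_bit (b + i) a) = ?g (unset_bit (b + i) a) \<and>
      rotate (b + i) \<theta> f (set_bit (b + i) a) = ?g (set_bit (b + i) a)" for a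
  proof -
    let ?y = "take_bit m (drop_bit b a)"
    let ?h = "drop_bit (Suc i) ?y"
    have "\<theta> (set_bit (b + i) a) = tree_angle p i ?h" "\<theta> (unset_bit (b + i) a) = tree_angle p i ?h"
      by (simp_all only: \<theta>_def take_drop_bit_target[OF i] drop_bit_Suc_target)
    moreover have "F (set_bit (b + i) a) = F a" "F (unset_bit (b + i) a) = F a"
      using F i by simp_all
    \<comment> \<open>Before the step a set bit \<open>i\<close> carries no amplitude, so only the
      first column of the rotation matters.\<close>
    moreover have
      "tree_amp p (Suc i) (set_bit i ?y) = 0"
      "tree_amp p (Suc i) (unset_bit i ?y)
         = (if take_bit i ?y = 0 then complex_of_real (sqrt (subtree_weight p (Suc i) ?h)) else 0)"
      "tree_amp p i (set_bit i ?y)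
         = (if take_bit i ?y = 0 then complex_of_real (sqrt (subtree_weight p i (2 * ?h + 1))) else 0)"
      "tree_amp p i (unset_bit i ?y)
         = (if take_bit i ?y = 0 then complex_of_real (sqrt (subtree_weight p i (2 * ?h))) else 0)"
      by (simp_all only: tree_amp_def take_bit_Suc_set_bit take_bit_target drop_bit_Suc_target
          drop_bit_target if_False)
    moreover note tree_angle[of p i ?h, OF p]
    ultimately show ?thesis
      by (simp only: rotate_unset_bit rotate_set_bit f_def take_drop_bit_target[OF i])
        (simp del: subtree_weight.simps)
  qed
  have "rotate (b + i) \<theta> f a = ?g a" for a
    using both[of a] by (cases "bit a (b + i)") (simp_all only: set_bit_idle unset_bit_idle simp_thms)
  ultimately show ?thesis
    unfolding f_def by (simp only: fun_eq_iff) simp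
qed

lemma fold_tree_gates:
  assumes p: "\<And>y. 0 \<le> p y"
    and F: "\<And>a t. t \<in> {b..<b + m} \<Longrightarrow> F (set_bit t a) = F a \<and> F (unset_bit t a) = F a"
  shows "fold anc_action (tree_gates p b m)
      (\<lambda>a. F a * tree_amp p m (take_bit m (drop_bit b a)))
    = (\<lambda>a. F a * tree_amp p 0 (take_bit m (drop_bit b a)))"
proof -
  \<comment> \<open>Induction on the number \<open>i\<close> of qubits still to be treated, the
    topmost of them coming next.\<close>
  have "fold anc_action (concat (map (tree_step p b m) (rev [0..<i])))
      (\<lambda>a. F a * tree_amp p i (take_bit m (drop_bit b a)))
    = (\<lambda>a. F a * tree_amp p 0 (take_bit m (drop_bit b a)))" if "i \<le> m" for i
    using that
  proof (induction i)
    case (Suc i)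
    then have "fold anc_action (tree_step p b m i)
        (\<lambda>a. F a * tree_amp p (Suc i) (take_bit m (drop_bit b a)))
      = (\<lambda>a. F a * tree_amp p i (take_bit m (drop_bit b a)))"
      by (intro fold_tree_step p F) auto
    then show ?case
      using Suc by simp
  qed simp
  from this[of m] show ?thesis
    by (simp add: tree_gates_def)
qed

lemma tree_gates_ancillary:
  "b + m \<le> anc_qubits N \<Longrightarrow> g \<in> set (tree_gates p b m) \<Longrightarrow> ancillary_gate N g"
  by (auto simp: tree_gates_def tree_step_def elim!: multiplexed_rotation_ancillary[rotated 2])

text \<open>The rotation of qubit \<open>i\<close> has \<open>m - Suc i\<close> controls; a bound
  uniform in \<open>i\<close> is summed over the \<open>m\<close> steps.\<close>

lemma length_tree_gates: "length (tree_gates p b m) \<le> m * (3 * 2 ^ m)"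
proof -
  have "length (tree_step p b m i) \<le> 3 * 2 ^ m" for i
  proof -
    have "length (tree_step p b m i) \<le> 3 * 2 ^ (m - Suc i) - 2"
      unfolding tree_step_def by (rule order_trans[OF length_multiplexed_rotation]) simp
    also have "\<dots> \<le> 3 * 2 ^ m"
      by (rule order_trans[OF diff_le_self]) (simp add: power_increasing)
    finally show ?thesis .
  qed
  then have "sum_list (map (\<lambda>i. length (tree_step p b m i)) (rev [0..<m]))
      \<le> sum_list (map (\<lambda>_. 3 * 2 ^ m) (rev [0..<m]))"
    by (intro sum_list_mono) simp
  then show ?thesis
    by (simp add: tree_gates_def length_concat comp_def sum_list_triv)
qed

subsection \<open>Preparation of the ancillary register\<close>

lemma anc_qubits_eq_offset: "anc_qubits N = sys_offset (N - 1)"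
  by (simp add: anc_qubits_def sys_offset_def)

lemma sys_offset_Suc: "sys_offset (Suc k) = sys_offset k + sys_qubits k"
  by (simp add: sys_offset_def)

lemma sys_offset_mono: "k \<le> l \<Longrightarrow> sys_offset k \<le> sys_offset l"
  unfolding sys_offset_def by (rule sum_mono2) auto

lemma sys_qubits_eq: "sys_qubits k = prim_qubits (k + 2)"
  by (simp only: sys_qubits_def prim_qubits_def)

lemma le_exp_sys_qubits: "k + 2 \<le> 2 ^ sys_qubits k"
  unfolding sys_qubits_eq by (rule less_exp_prim_qubits)

lemma sys_label_less: "sys_label k a < 2 ^ sys_qubits k"
  by (simp add: sys_label_def)

text \<open>Different systems occupy disjoint ranges of bits.\<close>

lemma sys_label_other_bit:
  assumes "k \<noteq> l" "t \<in> {sys_offset l..<sys_offset l + sys_qubits l}"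
  shows "sys_label k (set_bit t a) = sys_label k a" "sys_label k (unset_bit t a) = sys_label k a"
proof -
  have "t \<notin> {sys_offset k..<sys_offset k + sys_qubits k}"
  proof (cases "k < l")
    case True
    then show ?thesis
      using assms sys_offset_mono[of "Suc k" l] by (simp add: sys_offset_Suc)
  next
    case False
    then show ?thesis
      using assms sys_offset_mono[of "Suc l" k] by (simp add: sys_offset_Suc)
  qed
  then have "t \<noteq> sys_offset k + n" if "n < sys_qubits k" for n
    using that by auto
  then show "sys_label k (set_bit t a) = sys_label k a" "sys_label k (unset_bit t a) = sys_label k a"
    by (intro bit_eqI; force simp: sys_label_def bit_take_bit_iff bit_drop_bit_eq bit_set_bit_iff
        bit_unset_bit_iff)+
qed

lemma sys_labels_eqI:
  assumes "a < 2 ^ sys_offset M" "a' < 2 ^ sys_offset M"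
    and "\<And>k. k < M \<Longrightarrow> sys_label k a = sys_label k a'"
  shows "a = a'"
proof -
  \<comment> \<open>Agreement spreads from the low bits upwards, one system at a time.\<close>
  have "take_bit (sys_offset K) a = take_bit (sys_offset K) a'" if "K \<le> M" for K
    using that
  proof (induction K)
    case 0
    show ?case
      by (simp add: sys_offset_def)
  next
    case (Suc K)
    show ?case
    proof (rule bit_eqI)
      fix n
      have label: "bit (sys_label K a) (n - sys_offset K) = bit (sys_label K a') (n - sys_offset K)"
        using assms(3)[of K] Suc.prems by simp
      have "bit (take_bit (sys_offset K) a) n = bit (take_bit (sys_offset K) a') n"
        using Suc by simp
      with label show "bit (take_bit (sys_offset (Suc K)) a) n = bit (take_bit (sys_offset (Suc K)) a') n"
        by (cases "n < sys_offset K")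
          (auto simp: sys_label_def bit_take_bit_iff bit_drop_bit_eq sys_offset_Suc)
    qed
  qed
  from this[of M] show ?thesis
    using assms(1,2) by (simp add: take_bit_nat_eq_self)
qed

lemma sys_labels_exist:
  assumes "\<And>k. k < M \<Longrightarrow> j k < 2 ^ sys_qubits k"
  shows "\<exists>a < 2 ^ sys_offset M. \<forall>k < M. sys_label k a = j k"
  using assms
proof (induction M)
  case (Suc M)
  then obtain a where a: "a < 2 ^ sys_offset M" "\<forall>k < M. sys_label k a = j k"
    by auto
  \<comment> \<open>The label of the new system is placed right above the bits already
    built.\<close>
  let ?b = "a + push_bit (sys_offset M) (j M)"
  have low: "take_bit (sys_offset M) ?b = a" and high: "drop_bit (sys_offset M) ?b = j M"
    using a(1) by (simp_all add: push_bit_eq_mult take_bit_eq_mod drop_bit_eq_div)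
  have "sys_label k ?b = j k" if "k < M" for k
  proof -
    have "sys_label k ?b = sys_label k (take_bit (sys_offset M) ?b)"
      using sys_offset_mono[of "Suc k" M] that
      by (auto intro!: bit_eqI simp: sys_label_def bit_take_bit_iff bit_drop_bit_eq sys_offset_Suc)
    then show ?thesis
      unfolding low using a that by simp
  qed
  moreover have "sys_label M ?b = j M"
    unfolding sys_label_def high using Suc.prems[of M] by (simp add: take_bit_nat_eq_self)
  moreover have "?b < 2 ^ sys_offset (Suc M)"
  proof -
    have "(j M + 1) * 2 ^ sys_offset M \<le> 2 ^ sys_qubits M * 2 ^ sys_offset M"
      using Suc.prems[of M] by (intro mult_le_mono1) simp
    then show ?thesis
      using a(1) by (simp add: sys_offset_Suc power_add push_bit_eq_mult algebra_simps)
  qed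
  ultimately show ?case
    by (auto simp: less_Suc_eq intro!: exI[of _ ?b])
qed (auto intro!: exI[of _ 0])

text \<open>The squared amplitudes of \<open>Pi_state k\<close>, to be fed into the tree.\<close>

definition sys_weight :: "nat \<Rightarrow> nat \<Rightarrow> real" where
  "sys_weight k y = (if y \<le> k + 1 then 1 / real (k + 2) else 0)"

definition preparation :: "nat \<Rightarrow> gate list" where
  "preparation N =
     concat (map (\<lambda>k. tree_gates (sys_weight k) (sys_offset k) (sys_qubits k)) [0..<N - 1])"

lemma preparation_ancillary:
  assumes "g \<in> set (preparation N)"
  shows "ancillary_gate N g"
proof -
  obtain k where k: "k < N - 1" "g \<in> set (tree_gates (sys_weight k) (sys_offset k) (sys_qubits k))"
    using assms by (auto simp: preparation_def)
  have "sys_offset k + sys_qubits k \<le> anc_qubits N"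
    using k sys_offset_mono[of "Suc k" "N - 1"] by (simp add: anc_qubits_eq_offset sys_offset_Suc)
  then show ?thesis
    using k tree_gates_ancillary by blast
qed

text \<open>The total weight is 1, so the root of the tree holds amplitude 1: the system starts in
  basis state 0.\<close>

lemma tree_amp_initial:
  assumes "y < 2 ^ sys_qubits k"
  shows "tree_amp (sys_weight k) (sys_qubits k) y = of_bool (y = 0)"
proof -
  have "subtree_weight (sys_weight k) (sys_qubits k) 0 = (\<Sum>y < 2 ^ sys_qubits k. sys_weight k y)"
    by (simp add: subtree_weight_eq_sum)
  also have "\<dots> = (\<Sum>y < k + 2. 1 / real (k + 2))"
    by (rule sum.mono_neutral_cong_right)
      (use le_exp_sys_qubits[of k] in \<open>auto simp: sys_weight_def\<close>)
  also have "\<dots> = 1"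
    by simp
  finally show ?thesis
    using assms by (auto simp: tree_amp_def take_bit_nat_eq_self)
qed

lemma tree_amp_final:
  assumes "y < 2 ^ sys_qubits k"
  shows "tree_amp (sys_weight k) 0 y = Pi_state k $ y"
  using assms by (simp add: tree_amp_def sys_weight_def Pi_state_def real_sqrt_divide)

text \<open>The first \<open>M\<close> systems are prepared and the others are still in basis state
  0.\<close>

definition partial_state :: "nat \<Rightarrow> nat \<Rightarrow> nat \<Rightarrow> complex" where
  "partial_state N M a = (\<Prod>k < N - 1.
     if k < M then Pi_state k $ sys_label k a else of_bool (sys_label k a = 0))"

text \<open>The factor of system \<open>M\<close> is split off; the remaining product
  \<open>F\<close> ignores the bits of that system, as \<open>fold_tree_gates\<close>
  requires.\<close>

lemma fold_preparation_system:
  assumes M: "M < N - 1"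
  shows "fold anc_action (tree_gates (sys_weight M) (sys_offset M) (sys_qubits M)) (partial_state N M)
    = partial_state N (Suc M)"
proof -
  define F where "F a = (\<Prod>k \<in> {..<N - 1} - {M}.
     if k < M then Pi_state k $ sys_label k a else of_bool (sys_label k a = 0))" for a
  \<comment> \<open>With \<open>M\<close> left out of the product, the conditions
    \<open>k < M\<close> and \<open>k < Suc M\<close> agree.\<close>
  have F': "F a = (\<Prod>k \<in> {..<N - 1} - {M}.
     if k < Suc M then Pi_state k $ sys_label k a else of_bool (sys_label k a = 0))" for a
    unfolding F_def by (rule prod.cong) auto
  have split: "(\<Prod>k < N - 1. h k) = (\<Prod>k \<in> {..<N - 1} - {M}. h k) * h M" for h :: "nat \<Rightarrow> complex"
    using M by (subst prod.remove[of _ M]) auto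
  have "partial_state N M = (\<lambda>a. F a * tree_amp (sys_weight M) (sys_qubits M) (sys_label M a))"
    unfolding partial_state_def split F_def by (simp add: tree_amp_initial sys_label_less)
  moreover have "partial_state N (Suc M) = (\<lambda>a. F a * tree_amp (sys_weight M) 0 (sys_label M a))"
    unfolding partial_state_def split F' by (simp add: tree_amp_final sys_label_less)
  moreover have "F (set_bit t a) = F a \<and> F (unset_bit t a) = F a"
    if "t \<in> {sys_offset M..<sys_offset M + sys_qubits M}" for a t
  proof -
    have "sys_label k (set_bit t a) = sys_label k a" "sys_label k (unset_bit t a) = sys_label k a"
      if "k \<in> {..<N - 1} - {M}" for k
      using sys_label_other_bit[of k M t a] that \<open>t \<in> _\<close> by simp_all
    then show ?thesis
      unfolding F_def by (intro conjI prod.cong) simp_all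
  qed
  then have "fold anc_action (tree_gates (sys_weight M) (sys_offset M) (sys_qubits M))
      (\<lambda>a. F a * tree_amp (sys_weight M) (sys_qubits M) (sys_label M a))
    = (\<lambda>a. F a * tree_amp (sys_weight M) 0 (sys_label M a))"
    unfolding sys_label_def by (intro fold_tree_gates) (auto simp: sys_weight_def)
  ultimately show ?thesis
    by (simp only:)
qed

lemma fold_preparation: "fold anc_action (preparation N) (partial_state N 0) = partial_state N (N - 1)"
proof -
  have "fold anc_action
      (concat (map (\<lambda>k. tree_gates (sys_weight k) (sys_offset k) (sys_qubits k)) [0..<M]))
      (partial_state N 0) = partial_state N M" if "M \<le> N - 1" for M
    using that by (induction M) (simp_all add: fold_preparation_system)
  then show ?thesis
    by (simp add: preparation_def)
qed

lemma partial_state_0: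
  "vec (2 ^ anc_qubits N) (partial_state N 0) = unit_vec (2 ^ anc_qubits N) 0"
proof (rule eq_vecI)
  fix a assume "a < dim_vec (unit_vec (2 ^ anc_qubits N) 0 :: complex vec)"
  then have a: "a < 2 ^ sys_offset (N - 1)"
    by (simp add: anc_qubits_eq_offset)
  have "partial_state N 0 a = of_bool (\<forall>k < N - 1. sys_label k a = 0)"
    by (auto simp: partial_state_def)
  also have "(\<forall>k < N - 1. sys_label k a = 0) \<longleftrightarrow> a = 0"
    using sys_labels_eqI[OF a, of 0] by (auto simp: sys_label_def)
  finally show "vec (2 ^ anc_qubits N) (partial_state N 0) $ a = unit_vec (2 ^ anc_qubits N) 0 $ a"
    using a by (auto simp: anc_qubits_eq_offset)
qed simp

lemma partial_state_final:
  "vec (2 ^ anc_qubits N) (partial_state N (N - 1)) = anc_product_state N"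
  by (auto simp: partial_state_def anc_product_state_def intro!: eq_vecI prod.cong)

lemma circuit_mat_preparation:
  "circuit_mat N (preparation N) *\<^sub>v tensor_state N \<psi> (unit_vec (2 ^ anc_qubits N) 0)
     = tensor_state N \<psi> (anc_product_state N)"
  using circuit_mat_apply_tensor[of "preparation N" N \<psi> "partial_state N 0",
      OF ballI[OF preparation_ancillary]]
  by (simp only: fold_preparation partial_state_0 partial_state_final)

section \<open>Factorisation of permutations\<close>

primrec Pi_product :: "nat \<Rightarrow> (nat \<Rightarrow> nat) \<Rightarrow> nat \<Rightarrow> nat" where
  "Pi_product 0 j = id"
| "Pi_product (Suc M) j = Pi_product M j \<circ> Pi_elem M (j M)"

lemma Pi_product_cong: "(\<And>k. k < M \<Longrightarrow> j k = j' k) \<Longrightarrow> Pi_product M j = Pi_product M j'"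
  by (induction M) simp_all

text \<open>Factor \<open>k\<close> moves only labels up to \<open>k + 1\<close>, so the factors
  below \<open>M\<close> move only labels up to \<open>M\<close>.\<close>

lemma Pi_product_permutes: "M < m \<Longrightarrow> Pi_product M j permutes {..<m}"
proof (induction M)
  case (Suc M)
  show ?case
    unfolding Pi_product.simps
    by (rule permutes_compose[OF Pi_elem_permutes]) (use Suc in simp_all)
qed (simp add: permutes_id)

text \<open>The rightmost transposition moves \<open>k + 1 - j\<close> up by one, and each further
  one continues the climb until the leftmost reaches \<open>k + 1\<close>.\<close>

lemma Pi_elem_to_top: "j \<le> k + 1 \<Longrightarrow> Pi_elem k j (k + 1 - j) = k + 1"
proof (induction j)
  case (Suc j)
  then have "adj_transp (k - j) (k + 1 - Suc j) = k + 1 - j"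
    by (simp add: adj_transp_def transpose_def Suc_diff_le)
  then show ?case
    using Suc by simp
qed simp

lemma Pi_product_inj:
  assumes "Pi_product M j = Pi_product M j'"
    and "\<And>k. k < M \<Longrightarrow> j k \<le> k + 1" "\<And>k. k < M \<Longrightarrow> j' k \<le> k + 1"
  shows "\<And>k. k < M \<Longrightarrow> j k = j' k"
  using assms
proof (induction M)
  case (Suc M)
  \<comment> \<open>The factors below \<open>M\<close> fix \<open>M + 1\<close>, so the last factor
    alone decides which label is sent there.\<close>
  have top: "Pi_product (Suc M) i (M + 1 - i M) = M + 1" if "i M \<le> M + 1" for i
    using Pi_elem_to_top[OF that] Pi_product_permutes[of M "M + 1" i]
    by (simp add: permutes_not_in)
  have "inj (Pi_product (Suc M) j)"
    by (rule permutes_inj[OF Pi_product_permutes[OF lessI]])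
  moreover have "Pi_product (Suc M) j (M + 1 - j M) = Pi_product (Suc M) j (M + 1 - j' M)"
    using top[of j] top[of j'] Suc.prems(3,4)[of M] unfolding Suc.prems(2) by simp
  ultimately have "M + 1 - j M = M + 1 - j' M"
    by (rule injD)
  then have eq: "j M = j' M"
    using Suc.prems(3,4)[of M] by linarith
  \<comment> \<open>The common right factor is surjective and can be cancelled.\<close>
  have "surj (Pi_elem M (j M))"
    by (rule permutes_surj[OF Pi_elem_permutes[OF lessI]])
  then have "Pi_product M j = Pi_product M j'"
    using Suc.prems(2) eq by (metis Pi_product.simps(2) surj_fun_eq)
  then show ?case
    using Suc eq by (cases "k = M") auto
qed simp

lemma Pi_product_surj:
  "\<pi> permutes {..<Suc M} \<Longrightarrow> \<exists>j. (\<forall>k < M. j k \<le> k + 1) \<and> Pi_product M j = \<pi>"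
proof (induction M arbitrary: \<pi>)
  case 0
  then have "\<pi> = id"
    by (simp add: lessThan_Suc)
  then show ?case
    by simp
next
  case (Suc M)
  \<comment> \<open>The preimage of the top label fixes the last factor: the digit
    \<open>M + 1 - i\<close> makes it send \<open>i\<close> to \<open>M + 1\<close> too, and
    dividing by it on the right leaves a permutation that fixes \<open>M + 1\<close>.\<close>
  define i where "i = inv_into UNIV \<pi> (M + 1)"
  define E where "E = Pi_elem M (M + 1 - i)"
  have \<pi>_i: "\<pi> i = M + 1"
    unfolding i_def by (rule permutes_inverses(1)[OF Suc.prems])
  have "i < Suc (Suc M)"
    using permutes_in_image[OF Suc.prems, of i] \<pi>_i by simp
  then have E_i: "E i = M + 1"
    using Pi_elem_to_top[of "M + 1 - i" M] by (simp add: E_def)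
  have E: "E permutes {..<Suc (Suc M)}"
    unfolding E_def by (rule Pi_elem_permutes) simp
  have "(\<pi> \<circ> inv_into UNIV E) permutes {..<Suc (Suc M)}"
    by (rule permutes_compose[OF permutes_inv[OF E] Suc.prems])
  moreover have "(\<pi> \<circ> inv_into UNIV E) (M + 1) = M + 1"
    using E_i \<pi>_i permutes_inverses(2)[OF E, of i] by simp
  moreover have "x = M + 1" if "x \<in> {..<Suc (Suc M)} - {..<Suc M}" for x
    using that by simp
  ultimately have "(\<pi> \<circ> inv_into UNIV E) permutes {..<Suc M}"
    by (metis permutes_superset)
  from Suc.IH[OF this] obtain j
    where j: "\<forall>k < M. j k \<le> k + 1" "Pi_product M j = \<pi> \<circ> inv_into UNIV E"
    by blast
  let ?j = "j(M := M + 1 - i)"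
  have "Pi_product (Suc M) ?j = Pi_product M j \<circ> E"
    using Pi_product_cong[of M ?j j] by (simp add: E_def)
  also have "\<dots> = \<pi>"
    unfolding j(2) comp_assoc permutes_inv_o(2)[OF E] by simp
  finally have "Pi_product (Suc M) ?j = \<pi>" .
  moreover have "\<forall>k < Suc M. ?j k \<le> k + 1"
    using j(1) by (auto simp: less_Suc_eq)
  ultimately show ?case
    by blast
qed

section \<open>Sampling\<close>

lemma Pi_elem_less:
  assumes "k < N - 1"
  shows "basis_preserving (prim_qubits N) (Pi_elem k j)"
proof -
  have "k + 1 < 2 ^ prim_qubits N"
    using assms less_exp_prim_qubits[of N] by simp
  from permutes_in_image[OF Pi_elem_permutes[OF this]] show ?thesis
    by auto
qed

text \<open>A label of system \<open>k\<close> above \<open>k + 1\<close> controls no gate, and has the same effect as label \<open>0\<close>.\<close>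

definition digit :: "nat \<Rightarrow> nat \<Rightarrow> nat" where
  "digit k a = (if sys_label k a < k + 2 then sys_label k a else 0)"

definition outcome_perm :: "nat \<Rightarrow> nat \<Rightarrow> nat \<Rightarrow> nat" where
  "outcome_perm N a = Pi_product (N - 1) (\<lambda>k. digit k a)"

lemma outcome_perm_permutes: "0 < N \<Longrightarrow> outcome_perm N a permutes {..<N}"
  unfolding outcome_perm_def by (rule Pi_product_permutes) simp

text \<open>The controls ask for distinct labels of the same system, so at most one block acts on
  any ancillary label.\<close>

lemma circuit_mat_system_blocks:
  assumes k: "k < N - 1"
  shows "circuit_mat N (concat (map (Pi_block N k) [0..<L]))
    = controlled_mat N (\<lambda>a. if sys_label k a < L then Pi_elem k (sys_label k a) else id)"
proof (induction L)
  case 0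
  have "(\<lambda>a. if sys_label k a < 0 then Pi_elem k (sys_label k a) else id) = (\<lambda>_. id)"
    by simp
  then show ?case
    by (simp only: controlled_mat_id upt_0 list.map concat.simps circuit_mat.simps)
next
  case (Suc L)
  have "circuit_mat N (concat (map (Pi_block N k) [0..<Suc L]))
      = controlled_mat N (\<lambda>a. if control_holds (Some (k, L)) a then Pi_elem k L else id)
        * controlled_mat N (\<lambda>a. if sys_label k a < L then Pi_elem k (sys_label k a) else id)"
    using Suc by (simp add: circuit_mat_append circuit_mat_Pi_block[OF k]
        primary_op_basis_map_mat[OF Pi_elem_less[OF k]])
  also have "\<dots> = controlled_mat N (\<lambda>a. (if control_holds (Some (k, L)) a then Pi_elem k L else id)
      \<circ> (if sys_label k a < L then Pi_elem k (sys_label k a) else id))"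
    by (rule controlled_mat_mult) (use Pi_elem_less[OF k] in auto)
  also have "\<dots> = controlled_mat N
      (\<lambda>a. if sys_label k a < Suc L then Pi_elem k (sys_label k a) else id)"
    by (rule controlled_mat_cong) (auto simp: less_Suc_eq)
  finally show ?case .
qed

text \<open>The blocks of the highest system act first and give the rightmost factor, in accordance
  with the recursion of \<open>Pi_product\<close>.\<close>

lemma circuit_mat_blocks:
  "M \<le> N - 1 \<Longrightarrow>
     circuit_mat N (concat (map (\<lambda>k. concat (map (Pi_block N k) [0..<k + 2])) (rev [0..<M])))
       = controlled_mat N (\<lambda>a. Pi_product M (\<lambda>k. digit k a))"
proof (induction M)
  case 0
  show ?case
    by (simp only: controlled_mat_id Pi_product.simps upt_0 rev.simps list.map concat.simps
        circuit_mat.simps)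
next
  case (Suc M)
  let ?G = "\<lambda>a. if sys_label M a < M + 2 then Pi_elem M (sys_label M a) else id"
  have "circuit_mat N (concat (map (\<lambda>k. concat (map (Pi_block N k) [0..<k + 2])) (rev [0..<Suc M])))
      = controlled_mat N (\<lambda>a. Pi_product M (\<lambda>k. digit k a)) * controlled_mat N ?G"
  proof -
    have "rev [0..<Suc M] = M # rev [0..<M]"
      by simp
    moreover have "M < N - 1" "M \<le> N - 1"
      using Suc.prems by simp_all
    ultimately show ?thesis
      by (simp only: list.map concat.simps circuit_mat_append Suc.IH circuit_mat_system_blocks)
  qed
  also have "\<dots> = controlled_mat N (\<lambda>a. Pi_product M (\<lambda>k. digit k a) \<circ> ?G a)"
    by (rule controlled_mat_mult) (use Pi_elem_less[of M N] Suc.prems in auto)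
  \<comment> \<open>A label from \<open>M + 2\<close> on triggers no block; \<open>digit\<close>
    replaces it by 0, and \<open>Pi_elem M 0\<close> is the identity.\<close>
  also have "\<dots> = controlled_mat N (\<lambda>a. Pi_product (Suc M) (\<lambda>k. digit k a))"
    by (rule controlled_mat_cong) (simp add: digit_def)
  finally show ?case .
qed

section \<open>Amplitudes and probabilities of the outcomes\<close>

lemma norm_sq_smult: "norm_sq (c \<cdot>\<^sub>v v) = (cmod c)\<^sup>2 * norm_sq v"
  by (simp add: norm_sq_def norm_mult power_mult_distrib sum_distrib_left)

lemma norm_sq_permutation:
  assumes f: "f permutes {..<2 ^ m}" and v: "v \<in> carrier_vec (2 ^ m)"
  shows "norm_sq (basis_map_mat m f *\<^sub>v v) = norm_sq v"
proof -
  have "(basis_map_mat m f *\<^sub>v v) $ f x = v $ x" if x: "x < 2 ^ m" for x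
  proof -
    have "f x < 2 ^ m"
      using permutes_in_image[OF f, of x] x by simp
    then have "(basis_map_mat m f *\<^sub>v v) $ f x = (\<Sum>y < 2 ^ m. if f x = f y then v $ y else 0)"
      by (rule basis_map_mat_apply[OF v])
    also have "\<dots> = v $ x"
      using x by (simp add: inj_eq[OF permutes_inj[OF f]])
    finally show ?thesis .
  qed
  then have "(\<Sum>x < 2 ^ m. (cmod ((basis_map_mat m f *\<^sub>v v) $ f x))\<^sup>2) = (\<Sum>x < 2 ^ m. (cmod (v $ x))\<^sup>2)"
    by (intro sum.cong) (simp_all del: index_mult_mat_vec)
  then show ?thesis
    using sum.permute[OF f, of "\<lambda>x. (cmod ((basis_map_mat m f *\<^sub>v v) $ x))\<^sup>2"] v
    by (simp add: norm_sq_def comp_def del: index_mult_mat_vec)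
qed

text \<open>The outcomes of nonzero amplitude; labels above \<open>k + 1\<close> exist when
  \<open>k + 2\<close> is not a power of two.\<close>

definition valid_outcome :: "nat \<Rightarrow> nat \<Rightarrow> bool" where
  "valid_outcome N a \<longleftrightarrow> (\<forall>k < N - 1. sys_label k a \<le> k + 1)"

text \<open>The product of \<open>k + 2\<close> over \<open>k < M\<close> is
  \<open>fact (Suc M)\<close>.\<close>

lemma prod_inverse_sqrt: "(\<Prod>k < M. 1 / sqrt (real (k + 2))) = 1 / sqrt (fact (Suc M))"
  by (induction M) (simp_all add: real_sqrt_mult[symmetric] mult.commute)

lemma anc_product_state_amplitude:
  assumes "0 < N" "a < 2 ^ anc_qubits N"
  shows "anc_product_state N $ a
    = (if valid_outcome N a then complex_of_real (1 / sqrt (fact N)) else 0)"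
proof -
  have "anc_product_state N $ a
      = (\<Prod>k < N - 1. if sys_label k a \<le> k + 1 then complex_of_real (1 / sqrt (real (k + 2))) else 0)"
    using assms(2) by (simp add: anc_product_state_def Pi_state_def sys_label_less)
  also have "\<dots> = (if valid_outcome N a
      then (\<Prod>k < N - 1. complex_of_real (1 / sqrt (real (k + 2)))) else 0)"
    by (auto simp: valid_outcome_def intro!: prod.cong)
  also have "(\<Prod>k < N - 1. complex_of_real (1 / sqrt (real (k + 2))))
      = complex_of_real (1 / sqrt (fact N))"
    unfolding of_real_prod[symmetric] prod_inverse_sqrt using assms(1) by simp
  finally show ?thesis .
qed

text \<open>Existence packs the digits of a factorisation into a label, and uniqueness is that of
  the factorisation. An invalid label has some digit replaced by 0 and would repeat a
  permutation.\<close>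

lemma ex1_valid_outcome:
  assumes \<pi>: "\<pi> permutes {..<N}" and N: "0 < N"
  shows "\<exists>!a. a < 2 ^ anc_qubits N \<and> valid_outcome N a \<and> outcome_perm N a = \<pi>"
proof -
  have valid_perm: "outcome_perm N a = Pi_product (N - 1) (\<lambda>k. sys_label k a)"
    if "valid_outcome N a" for a
    unfolding outcome_perm_def using that
    by (intro Pi_product_cong) (simp add: valid_outcome_def digit_def less_Suc_eq_le)
  obtain j where j: "\<forall>k < N - 1. j k \<le> k + 1" "Pi_product (N - 1) j = \<pi>"
    using Pi_product_surj[of \<pi> "N - 1"] \<pi> N by auto
  have "j k < 2 ^ sys_qubits k" if "k < N - 1" for k
    using j(1) that le_exp_sys_qubits[of k] by fastforce
  then obtain a where a: "a < 2 ^ anc_qubits N" "\<forall>k < N - 1. sys_label k a = j k"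
    using sys_labels_exist[of "N - 1" j] by (auto simp: anc_qubits_eq_offset)
  have "valid_outcome N a"
    using a j by (simp add: valid_outcome_def)
  moreover have "Pi_product (N - 1) (\<lambda>k. sys_label k a) = \<pi>"
    using a(2) j(2) Pi_product_cong[of "N - 1" "\<lambda>k. sys_label k a" j] by simp
  ultimately show ?thesis
  proof (intro ex1I[of _ a] conjI a(1))
    fix b assume b: "b < 2 ^ anc_qubits N \<and> valid_outcome N b \<and> outcome_perm N b = \<pi>"
    assume valid_a: "valid_outcome N a" and perm_a: "Pi_product (N - 1) (\<lambda>k. sys_label k a) = \<pi>"
    have "Pi_product (N - 1) (\<lambda>k. sys_label k b) = Pi_product (N - 1) (\<lambda>k. sys_label k a)"
      using b perm_a valid_perm[of b] by metis
    then have "sys_label k b = sys_label k a" if "k < N - 1" for k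
      by (rule Pi_product_inj) (use b valid_a that in \<open>auto simp: valid_outcome_def\<close>)
    then show "b = a"
      using sys_labels_eqI[of b "N - 1" a] a(1) b by (simp add: anc_qubits_eq_offset)
  qed (simp_all add: valid_perm)
qed

lemma sampling_circuit_samples_uniformly:
  assumes N: "0 < N"
  shows "samples_uniformly N (sampling_circuit N (preparation N) (Pi_block N))"
  unfolding samples_uniformly_def
proof (intro exI[of _ "outcome_perm N"] ballI impI)
  fix \<psi> :: "complex vec"
  assume \<psi>: "\<psi> \<in> carrier_vec (2 ^ prim_qubits N)" "norm_sq \<psi> = 1"
  let ?\<Phi> = "output_state N (sampling_circuit N (preparation N) (Pi_block N)) \<psi>"
  let ?P = "\<lambda>a. basis_map_mat (prim_qubits N) (outcome_perm N a) *\<^sub>v \<psi>"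
  have perm: "outcome_perm N a permutes {..<2 ^ prim_qubits N}" for a
    by (rule permutes_subset[OF outcome_perm_permutes[OF N]])
      (use less_exp_prim_qubits[of N] in auto)
  then have less: "basis_preserving (prim_qubits N) (outcome_perm N a)" for a
    using permutes_in_image[OF perm[of a]] by auto
  have "circuit_mat N (sampling_circuit N (preparation N) (Pi_block N))
      = controlled_mat N (outcome_perm N) * circuit_mat N (preparation N)"
    unfolding sampling_circuit_def circuit_mat_append circuit_mat_blocks[OF order_refl]
      outcome_perm_def by (rule refl)
  then have out: "?\<Phi> = controlled_mat N (outcome_perm N) *\<^sub>v tensor_state N \<psi> (anc_product_state N)"
    by (simp only: output_state_def circuit_mat_preparation
        assoc_mult_mat_vec[OF controlled_mat_carrier circuit_mat_carrier tensor_state_carrier])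
  have branch: "outcome_branch N ?\<Phi> a = anc_product_state N $ a \<cdot>\<^sub>v ?P a"
    if "a < 2 ^ anc_qubits N" for a
    unfolding out by (rule controlled_mat_apply_tensor[OF \<psi>(1) less that])
  have prob: "outcome_prob N ?\<Phi> a = (if valid_outcome N a then 1 / fact N else 0)"
    if a: "a < 2 ^ anc_qubits N" for a
    unfolding outcome_prob_def branch[OF a] norm_sq_smult norm_sq_permutation[OF perm \<psi>(1)] \<psi>(2)
      anc_product_state_amplitude[OF N a]
    by (simp add: norm_divide power_divide)
  show "(\<forall>a < 2 ^ anc_qubits N. outcome_prob N ?\<Phi> a \<noteq> 0 \<longrightarrow>
       outcome_perm N a permutes {..<N} \<and> post_state N ?\<Phi> a = ?P a) \<and>
    (\<forall>\<pi>. \<pi> permutes {..<N} \<longrightarrow>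
       (\<Sum>a | a < 2 ^ anc_qubits N \<and> outcome_perm N a = \<pi>. outcome_prob N ?\<Phi> a) = 1 / fact N)"
  proof (intro conjI allI impI)
    fix a assume a: "a < 2 ^ anc_qubits N" "outcome_prob N ?\<Phi> a \<noteq> 0"
    show "outcome_perm N a permutes {..<N}"
      by (rule outcome_perm_permutes[OF N])
    have "valid_outcome N a"
      using a by (simp add: prob split: if_splits)
    then have "post_state N ?\<Phi> a
        = (complex_of_real (1 / sqrt (1 / fact N)) * complex_of_real (1 / sqrt (fact N))) \<cdot>\<^sub>v ?P a"
      unfolding post_state_def branch[OF a(1)] prob[OF a(1)] anc_product_state_amplitude[OF N a(1)]
      by (simp add: smult_smult_assoc)
    \<comment> \<open>The amplitude is the positive root of its probability, so normalising leaves
      no phase.\<close>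
    also have "complex_of_real (1 / sqrt (1 / fact N)) * complex_of_real (1 / sqrt (fact N)) = 1"
      unfolding of_real_mult[symmetric] by (simp add: real_sqrt_divide)
    finally show "post_state N ?\<Phi> a = ?P a"
      by simp
  next
    fix \<pi> assume "\<pi> permutes {..<N}"
    from ex1_valid_outcome[OF this N] obtain a
      where a: "a < 2 ^ anc_qubits N" "valid_outcome N a" "outcome_perm N a = \<pi>"
        and unique: "\<forall>b. b < 2 ^ anc_qubits N \<and> valid_outcome N b \<and> outcome_perm N b = \<pi> \<longrightarrow> b = a"
      by (elim ex1E) blast
    \<comment> \<open>All other labels with this permutation are invalid and have probability 0, so
      the sum keeps a single term.\<close>
    have invalid: "outcome_prob N ?\<Phi> b = 0"
      if "b \<in> {b. b < 2 ^ anc_qubits N \<and> outcome_perm N b = \<pi>} - {a}" for b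
    proof -
      have "\<not> valid_outcome N b"
        using that unique by blast
      then show ?thesis
        using that by (simp add: prob)
    qed
    have "(\<Sum>b | b < 2 ^ anc_qubits N \<and> outcome_perm N b = \<pi>. outcome_prob N ?\<Phi> b)
        = (\<Sum>b \<in> {a}. outcome_prob N ?\<Phi> b)"
      by (rule sum.mono_neutral_right) (use a invalid in simp_all)
    also have "\<dots> = 1 / fact N"
      using a by (simp add: prob)
    finally show "(\<Sum>b | b < 2 ^ anc_qubits N \<and> outcome_perm N b = \<pi>. outcome_prob N ?\<Phi> b)
      = 1 / fact N" .
  qed
qed

section \<open>Size of the circuit\<close>

lemma prim_qubits_mono: "0 < M \<Longrightarrow> M \<le> N \<Longrightarrow> prim_qubits M \<le> prim_qubits N"
  unfolding prim_qubits_def by (intro nat_mono ceiling_mono) simp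

text \<open>Rounding up costs at most 1, which is itself at most \<open>log 2 (real N)\<close> from
  \<open>N = 2\<close> on.\<close>

lemma prim_qubits_le_log:
  assumes "2 \<le> N"
  shows "real (prim_qubits N) \<le> log 2 (real N) + 1" "real (prim_qubits N) \<le> 2 * log 2 (real N)"
proof -
  have "1 \<le> log 2 (real N)"
    using assms by (simp add: le_log_iff)
  then show "real (prim_qubits N) \<le> log 2 (real N) + 1" "real (prim_qubits N) \<le> 2 * log 2 (real N)"
    unfolding prim_qubits_def by linarith+
qed

lemma exp_prim_qubits_le:
  assumes "2 \<le> N"
  shows "2 ^ prim_qubits N \<le> 2 * N"
proof -
  have "real (2 ^ prim_qubits N) = 2 powr real (prim_qubits N)"
    by (simp add: powr_realpow)
  also have "\<dots> \<le> 2 powr (log 2 (real N) + 1)"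
    using prim_qubits_le_log[OF assms] by simp
  also have "\<dots> = real (2 * N)"
    using assms by (simp add: powr_add)
  finally show ?thesis
    by (simp only: of_nat_le_iff)
qed

lemma sys_qubits_le: "k < N - 1 \<Longrightarrow> sys_qubits k \<le> prim_qubits N"
  unfolding sys_qubits_eq by (rule prim_qubits_mono) simp_all

text \<open>The primary register and the \<open>N - 1\<close> systems are \<open>N\<close> registers
  of at most \<open>prim_qubits N\<close> qubits each.\<close>

lemma total_qubits_le:
  assumes "0 < N"
  shows "total_qubits N \<le> N * prim_qubits N"
proof -
  have "anc_qubits N \<le> (\<Sum>k < N - 1. prim_qubits N)"
    unfolding anc_qubits_def by (rule sum_mono) (simp add: sys_qubits_le)
  then show ?thesis
    using assms by (cases N) (simp_all add: total_qubits_def)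
qed

lemma length_concat_map_le:
  assumes "\<And>x. x \<in> set xs \<Longrightarrow> length (f x) \<le> b"
  shows "length (concat (map f xs)) \<le> length xs * b"
  using assms by (induction xs) (simp_all add: add_mono)

text \<open>Each of fewer than \<open>N\<close> systems, on \<open>m\<close> qubits, costs at most
  \<open>m * (3 * 2 ^ m)\<close> gates, where \<open>2 ^ m\<close> is at most
  \<open>2 * N\<close>.\<close>

lemma length_preparation:
  assumes N: "2 \<le> N"
  shows "length (preparation N) \<le> 6 * N ^ 2 * prim_qubits N"
proof -
  have "length (tree_gates (sys_weight k) (sys_offset k) (sys_qubits k)) \<le> prim_qubits N * (6 * N)"
    if "k < N - 1" for k
  proof -
    have "(2::nat) ^ sys_qubits k \<le> 2 ^ prim_qubits N"
      using sys_qubits_le[OF that] by (rule power_increasing) simp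
    then have "3 * 2 ^ sys_qubits k \<le> 6 * N"
      using exp_prim_qubits_le[OF N] by linarith
    with sys_qubits_le[OF that]
    have "sys_qubits k * (3 * 2 ^ sys_qubits k) \<le> prim_qubits N * (6 * N)"
      by (rule mult_le_mono)
    then show ?thesis
      using length_tree_gates le_trans by blast
  qed
  then have "length (preparation N) \<le> length [0..<N - 1] * (prim_qubits N * (6 * N))"
    unfolding preparation_def by (intro length_concat_map_le) simp
  also have "\<dots> \<le> N * (prim_qubits N * (6 * N))"
    by (rule mult_le_mono1) simp
  also have "\<dots> = 6 * N ^ 2 * prim_qubits N"
    by (simp add: power2_eq_square)
  finally show ?thesis .
qed

lemma length_Pi_block:
  assumes "k < N - 1" "j < k + 2"
  shows "length (Pi_block N k j) \<le> N * (5 * prim_qubits N)"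
proof -
  have "0 < prim_qubits N"
    using assms by (intro prim_qubits_pos) simp
  \<comment> \<open>The hypotheses give \<open>j \<le> N\<close>, and
    \<open>4 * n + 1 \<le> 5 * n\<close> for positive \<open>n\<close>.\<close>
  then have "j * (4 * prim_qubits N + 1) \<le> N * (5 * prim_qubits N)"
    using assms by (intro mult_le_mono) simp_all
  then show ?thesis
    using length_Pi_gates[of "prim_qubits N" k j] by (simp add: Pi_block_def)
qed

text \<open>The constant is \<open>6 + 5\<close>: the quadratic cost of the preparation is bounded
  by a cubic one, and at most \<open>N ^ 2\<close> blocks have at most
  \<open>5 * N * prim_qubits N\<close> gates each.\<close>

lemma length_sampling_circuit:
  assumes N: "2 \<le> N"
  shows "length (sampling_circuit N (preparation N) (Pi_block N)) \<le> 11 * N ^ 3 * prim_qubits N"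
proof -
  have system: "length (concat (map (Pi_block N k) [0..<k + 2])) \<le> N * (N * (5 * prim_qubits N))"
    if "k < N - 1" for k
  proof -
    have "length (concat (map (Pi_block N k) [0..<k + 2]))
        \<le> length [0..<k + 2] * (N * (5 * prim_qubits N))"
      by (rule length_concat_map_le) (use length_Pi_block[OF that] in auto)
    also have "\<dots> \<le> N * (N * (5 * prim_qubits N))"
      using that by (intro mult_le_mono1) simp
    finally show ?thesis .
  qed
  have "length (concat (map (\<lambda>k. concat (map (Pi_block N k) [0..<k + 2])) (rev [0..<N - 1])))
      \<le> length (rev [0..<N - 1]) * (N * (N * (5 * prim_qubits N)))"
    by (rule length_concat_map_le) (use system in auto)
  also have "\<dots> \<le> N * (N * (N * (5 * prim_qubits N)))"
    by (intro mult_le_mono1) simp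
  also have "\<dots> = 5 * N ^ 3 * prim_qubits N"
    by (simp add: power3_eq_cube)
  finally have "length (concat (map (\<lambda>k. concat (map (Pi_block N k) [0..<k + 2])) (rev [0..<N - 1])))
      \<le> 5 * N ^ 3 * prim_qubits N" .
  moreover have "6 * N ^ 2 * prim_qubits N \<le> 6 * N ^ 3 * prim_qubits N"
    using N by (intro mult_le_mono1 mult_le_mono2 power_increasing) simp_all
  ultimately show ?thesis
    using length_preparation[OF N] unfolding sampling_circuit_def length_append by linarith
qed

theorem mainTheorem7:
  shows "\<exists>(prep :: nat \<Rightarrow> gate list) (B :: nat \<Rightarrow> nat \<Rightarrow> nat \<Rightarrow> gate list).
    (\<lambda>N. real (total_qubits N)) \<in> O(\<lambda>N. real N * log 2 (real N)) \<and>
    (\<lambda>N. real (length (sampling_circuit N (prep N) (B N)))) \<in> O(\<lambda>N. real N ^ 3 * log 2 (real N)) \<and>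
    (\<forall>N\<ge>3.
       (\<forall>g \<in> set (prep N). ancillary_gate N g) \<and>
       (\<forall>\<psi> \<in> carrier_vec (2 ^ prim_qubits N).
          circuit_mat N (prep N) *\<^sub>v tensor_state N \<psi> (unit_vec (2 ^ anc_qubits N) 0)
            = tensor_state N \<psi> (anc_product_state N)) \<and>
       (\<forall>k < N - 1. \<forall>j \<le> k + 1.
          (\<forall>g \<in> set (B N k j). primary_gate N g) \<and>
          circuit_mat N (B N k j)
            = primary_op N (Some (k, j)) (basis_map_mat (prim_qubits N) (Pi_elem k j))) \<and>
       samples_uniformly N (sampling_circuit N (prep N) (B N)))"
proof (intro exI[of _ preparation] exI[of _ Pi_block] conjI allI impI ballI)
  have qubits: "real (total_qubits N) \<le> 2 * (real N * log 2 (real N))" if "2 \<le> N" for N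
  proof -
    have "real (total_qubits N) \<le> real N * real (prim_qubits N)"
      using total_qubits_le[of N] that by (simp flip: of_nat_mult)
    also have "\<dots> \<le> real N * (2 * log 2 (real N))"
      by (intro mult_left_mono prim_qubits_le_log that) simp
    finally show ?thesis
      by simp
  qed
  show "(\<lambda>N. real (total_qubits N)) \<in> O(\<lambda>N. real N * log 2 (real N))"
  proof (rule bigoI)
    show "\<forall>\<^sub>F N in at_top. norm (real (total_qubits N)) \<le> 2 * norm (real N * log 2 (real N))"
      using eventually_ge_at_top[of 2]
    proof eventually_elim
      case (elim N)
      then show ?case
        using qubits[of N] abs_ge_self[of "real N * log 2 (real N)"]
        unfolding real_norm_def abs_of_nat by linarith
    qed
  qed
  have gates: "real (length (sampling_circuit N (preparation N) (Pi_block N)))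
      \<le> 22 * (real N ^ 3 * log 2 (real N))" if "2 \<le> N" for N
  proof -
    have "real (length (sampling_circuit N (preparation N) (Pi_block N)))
        \<le> real (11 * N ^ 3 * prim_qubits N)"
      by (simp only: of_nat_le_iff length_sampling_circuit[OF that])
    also have "\<dots> = 11 * real N ^ 3 * real (prim_qubits N)"
      by simp
    also have "\<dots> \<le> 11 * real N ^ 3 * (2 * log 2 (real N))"
      by (intro mult_left_mono prim_qubits_le_log that) simp
    finally show ?thesis
      by simp
  qed
  show "(\<lambda>N. real (length (sampling_circuit N (preparation N) (Pi_block N))))
      \<in> O(\<lambda>N. real N ^ 3 * log 2 (real N))"
  proof (rule bigoI)
    show "\<forall>\<^sub>F N in at_top. norm (real (length (sampling_circuit N (preparation N) (Pi_block N))))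
        \<le> 22 * norm (real N ^ 3 * log 2 (real N))"
      using eventually_ge_at_top[of 2]
    proof eventually_elim
      case (elim N)
      then show ?case
        using gates[of N] abs_ge_self[of "real N ^ 3 * log 2 (real N)"]
        unfolding real_norm_def abs_of_nat by linarith
    qed
  qed
next
  fix N :: nat and g assume "g \<in> set (preparation N)"
  then show "ancillary_gate N g"
    by (rule preparation_ancillary)
next
  fix N :: nat and \<psi> :: "complex vec"
  show "circuit_mat N (preparation N) *\<^sub>v tensor_state N \<psi> (unit_vec (2 ^ anc_qubits N) 0)
      = tensor_state N \<psi> (anc_product_state N)"
    by (rule circuit_mat_preparation)
next
  fix N k j :: nat and g assume "k < N - 1" "j \<le> k + 1" "g \<in> set (Pi_block N k j)"
  then show "primary_gate N g"
    by (rule Pi_block_primary)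
next
  fix N k j :: nat assume "k < N - 1"
  then show "circuit_mat N (Pi_block N k j)
      = primary_op N (Some (k, j)) (basis_map_mat (prim_qubits N) (Pi_elem k j))"
    by (rule circuit_mat_Pi_block)
next
  fix N :: nat assume "3 \<le> N"
  then show "samples_uniformly N (sampling_circuit N (preparation N) (Pi_block N))"
    by (intro sampling_circuit_samples_uniformly) simp
qed

end
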